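(* Let $k\ge2$ be an integer and put $l=(k^2+k-2)/2$. Let $w_l$ be a real number such that there exist a constant $C_1$ and a polynomial $Q$ of degree $l-1$ with $$\#\{(d_0,d_1,\dots,d_l)\in\mathbb{Z}_{\ge1}^{l+1} : d_0d_1^2\cdots d_l^2\le x\} = C_1x + x^{1/2}Q(\log x)+O(x^{w_l+\varepsilon})$$ for every $\varepsilon>0$. Then there exist a constant $A_k$ and a polynomial $P_k$ of degree $(k^2+k-4)/2$ such that for every $\varepsilon>0$ $$\sum_{n\le x}\tau^{(e)}_{k*}(n)=A_kx+x^{1/2}P_k(\log x)+O(x^{v_k+\varepsilon}),\qquad v_k=\max\bigl(w_l,1/3\bigr).$$
   Context: For a positive integer $a$, ${\mathfrak t}_k(a)$ is the number of ordered $k$-tuples $({\mathfrak d}_1,\dots,{\mathfrak d}_k)$ of nonzero Gaussian integers, each taken up to associates (multiplication by $\pm1,\pm i$), whose product is associated to $a$ (equivalently, ordered $k$-tuples of ideals of $\mathbb{Z}[i]$ with product $a\mathbb{Z}[i]$). $\tau^{(e)}_{k*}$ is the multiplicative arithmetic function on positive integers with $\tau^{(e)}_{k*}(p^a)={\mathfrak t}_k(a)$ for every prime $p$ and $a\ge1$. (By a result of Krätzel one may take $w_l=(2l+1)/(4l+5)$.) *)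

theory Defs
  imports "HOL-Analysis.Analysis" "HOL-Computational_Algebra.Computational_Algebra" "HOL-Library.Landau_Symbols"
begin

definition gauss_int :: "complex set" where
  "gauss_int = {z. Re z \<in> \<int> \<and> Im z \<in> \<int>}"

definition gassoc :: "complex \<Rightarrow> complex \<Rightarrow> bool" where
  "gassoc z w \<longleftrightarrow> (\<exists>u\<in>{1, -1, \<i>, -\<i>}. w = u * z)"

definition gclass :: "complex \<Rightarrow> complex set" where
  "gclass z = {w. gassoc z w}"

definition gt :: "nat \<Rightarrow> nat \<Rightarrow> nat" where
  "gt k a = card {cs. \<exists>zs. length zs = k \<and> (\<forall>z\<in>set zs. z \<in> gauss_int \<and> z \<noteq> 0)
                 \<and> gassoc (prod_list zs) (of_nat a) \<and> cs = map gclass zs}"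

definition tau_e :: "nat \<Rightarrow> nat \<Rightarrow> nat" where
  "tau_e k n = (\<Prod>p\<in>prime_factors n. gt k (multiplicity p n))"

definition Dcount :: "nat \<Rightarrow> real \<Rightarrow> nat" where
  "Dcount l x = card {d :: nat list. length d = l + 1 \<and> (\<forall>i\<in>set d. i \<ge> 1)
      \<and> real (d ! 0 * (\<Prod>i\<in>{1..l}. (d ! i)^2)) \<le> x}"

end

theory Submission
  imports Defs "HOL-Real_Asymp.Real_Asymp"
begin

text \<open>
  The value of the multiplicative function \<open>\<tau>\<close> at a prime power \<open>p\<^sup>a\<close> does not depend on \<open>p\<close>, so
  \<open>\<tau>\<close> is described by one power series with coefficients \<open>1, 1, l + 1, \<dots>\<close>, since the number of
  factorisations of 1 and of \<open>2 = -i(1 + i)\<^sup>2\<close> into \<open>k\<close> ideals is 1 and \<open>k(k + 1)/2 = l + 1\<close>. Dividing by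
  \<open>(1 - X)\<^sup>-\<^sup>1 (1 - X\<^sup>2)\<^sup>-\<^sup>l\<close>, the series of the function counted by \<open>Dcount l\<close>, leaves \<open>1 + O(X\<^sup>3)\<close> with
  radius of convergence at least 1. Hence \<open>\<tau>\<close> is the Dirichlet convolution of that function with some
  \<open>g\<close> whose Dirichlet series converges absolutely for \<open>s > 1/3\<close>, and
  \<open>\<Sum>\<^sub>n\<^sub>\<le>\<^sub>x \<tau>(n) = \<Sum>\<^sub>m g(m) Dcount l (x/m)\<close>. Inserting the expansion of \<open>Dcount\<close> gives
  \<open>P(L) = \<Sum>\<^sub>m g(m) m\<^sup>-\<^sup>1\<^sup>/\<^sup>2 Q(L - log m)\<close>. Its degree is that of \<open>Q\<close> because \<open>\<Sum>\<^sub>m g(m) m\<^sup>-\<^sup>1\<^sup>/\<^sup>2\<close> is a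
  convergent Euler product of positive factors.
\<close>

unbundle no vec_syntax

section \<open>Multiplicative functions and Dirichlet convolution\<close>

text \<open>\<open>c p a\<close> is the value at the prime power \<open>p ^ a\<close>. It may depend
  on \<open>p\<close>, so that a twist by \<open>n powr s\<close> stays within this form. The value
  at 0 is set separately: \<open>prime_factors 0\<close> is empty, so the product would give 1 there
  and spoil sums over all naturals.\<close>

definition multf :: "(nat \<Rightarrow> nat \<Rightarrow> real) \<Rightarrow> nat \<Rightarrow> real" where
  "multf c n = (if n = 0 then 0 else \<Prod>p\<in>prime_factors n. c p (multiplicity p n))"

lemma multf_0 [simp]: "multf c 0 = 0"
  by (simp add: multf_def)

lemma multf_1 [simp]: "multf c (Suc 0) = 1"
  by (simp add: multf_def)

lemma multf_prime_power_times:
  assumes p: "prime p" and m: "\<not> p dvd m" and c: "\<And>q. c q 0 = 1"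
  shows "multf c (p ^ a * m) = c p a * multf c m"
proof (cases "a = 0")
  case False
  have m0: "m \<noteq> 0" using m by (metis dvd_0_right)
  have pf: "prime_factors (p ^ a * m) = insert p (prime_factors m)"
    using p m0 False by (subst prime_factors_product) (auto simp: prime_factorization_prime_power)
  have pn: "p \<notin> prime_factors m" using m by auto
  have e1: "multiplicity p (p ^ a * m) = a"
    using p m m0 by (simp add: prime_elem_multiplicity_mult_distrib not_dvd_imp_multiplicity_0)
  have e2: "multiplicity q (p ^ a * m) = multiplicity q m" if "q \<in> prime_factors m" for q
  proof -
    have "q \<noteq> p" "prime q" using that pn by auto
    thus ?thesis using p m0
      by (simp add: prime_elem_multiplicity_mult_distrib multiplicity_distinct_prime_power)
  qed
  show ?thesis using pn p m0 e1 e2 by (simp add: multf_def pf cong: prod.cong)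
qed (use c in auto)

text \<open>Removing the full power of one prime per step leaves a cofactor coprime to that prime,
  so an identity between multiplicative functions is checked at one prime at a time.\<close>

lemma prime_power_times_induct [consumes 1, case_names one step]:
  assumes "n > 0" and one: "P 1"
    and step: "\<And>p a m. prime p \<Longrightarrow> a > 0 \<Longrightarrow> \<not> p dvd m \<Longrightarrow> P m \<Longrightarrow> P (p ^ a * m)"
  shows "P (n :: nat)"
  using \<open>n > 0\<close>
proof (induction n rule: less_induct)
  case (less n)
  show ?case
  proof (cases "n = 1")
    case False
    then obtain p where p: "prime p" "p dvd n" using prime_factor_nat by blast
    obtain m where m: "n = p ^ multiplicity p n * m" "\<not> p dvd m"
      using multiplicity_decompose'[of n p] p less.prems by (metis not_prime_unit nat_dvd_1_iff_1 bot_nat_0.not_eq_extremum)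
    have a: "multiplicity p n > 0" using p less.prems by (simp add: prime_multiplicity_gt_zero_iff)
    have "m > 0" using m(2) by (cases m) auto
    moreover have "m < n"
    proof -
      have "p ^ multiplicity p n > 1" using a p(1) prime_gt_1_nat one_less_power by blast
      hence "1 * m < p ^ multiplicity p n * m" using \<open>m > 0\<close> by (rule mult_strict_right_mono)
      thus ?thesis using m(1) by simp
    qed
    ultimately have "P m" using less.IH by blast
    hence "P (p ^ multiplicity p n * m)" by (rule step[OF p(1) a m(2)])
    thus ?thesis by (simp flip: m(1))
  qed (use one in simp)
qed

lemma bij_betw_divisors_prime_power_times:
  assumes p: "prime (p :: nat)" and m: "\<not> p dvd m"
  shows "bij_betw (\<lambda>(i, d). p ^ i * d) ({..a} \<times> {d. d dvd m}) {d. d dvd p ^ a * m}"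
proof -
  have inj: "inj_on (\<lambda>(i, d). p ^ i * d) ({..a} \<times> {d. d dvd m})"
  proof (rule inj_onI, clarsimp)
    fix i d j e assume de: "d dvd m" "e dvd m" and eq: "p ^ i * d = p ^ j * e"
    have nd: "\<not> p dvd d" "\<not> p dvd e" using de m dvd_trans by blast+
    hence "d \<noteq> 0" "e \<noteq> 0" by (metis dvd_0_right)+
    hence "multiplicity p (p ^ i * d) = i" "multiplicity p (p ^ j * e) = j"
      using p nd by (simp_all add: prime_elem_multiplicity_mult_distrib not_dvd_imp_multiplicity_0)
    hence "i = j" using eq by simp
    thus "i = j \<and> d = e" using eq p by auto
  qed
  have "(\<lambda>(i, d). p ^ i * d) ` ({..a} \<times> {d. d dvd m}) = {d. d dvd p ^ a * m}"
  proof (intro equalityI subsetI)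
    fix x assume "x \<in> (\<lambda>(i, d). p ^ i * d) ` ({..a} \<times> {d. d dvd m})"
    thus "x \<in> {d. d dvd p ^ a * m}" by (auto intro!: mult_dvd_mono le_imp_power_dvd)
  next
    fix x assume "x \<in> {d. d dvd p ^ a * m}"
    then obtain u v where uv: "x = u * v" "u dvd p ^ a" "v dvd m"
      by (auto elim: dvd_productE)
    then obtain i where "i \<le> a" "u = p ^ i" using p divides_primepow_nat by blast
    thus "x \<in> (\<lambda>(i, d). p ^ i * d) ` ({..a} \<times> {d. d dvd m})" using uv by force
  qed
  with inj show ?thesis by (simp add: bij_betw_def)
qed

text \<open>Dirichlet convolution is the Cauchy product of the local coefficients at each prime. A
  divisor of \<open>p ^ a * m\<close> splits uniquely into a power of \<open>p\<close> and a divisor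
  of \<open>m\<close>, so the divisor sum factors in the induction step.\<close>

lemma multf_conv:
  assumes c: "\<And>q. c q 0 = 1" and c': "\<And>q. c' q 0 = 1" and n: "n > 0"
  shows "multf (\<lambda>p a. \<Sum>i\<le>a. c p i * c' p (a - i)) n = (\<Sum>d | d dvd n. multf c d * multf c' (n div d))"
  using n
proof (induction n rule: prime_power_times_induct)
  case (step p a m)
  have m0: "m > 0" using step.hyps(3) by (cases m) auto
  have eq: "(case x of (i, d) \<Rightarrow> multf c (p ^ i * d) * multf c' (p ^ a * m div (p ^ i * d)))
      = (case x of (i, d) \<Rightarrow> (c p i * c' p (a - i)) * (multf c d * multf c' (m div d)))"
    if xin: "x \<in> {..a} \<times> {d. d dvd m}" for x
  proof -
    obtain i d where x: "x = (i, d)" "i \<le> a" "d dvd m" using xin by blast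
    then obtain e where e: "m = d * e" by (elim dvdE)
    have d0: "d > 0" using m0 e by (cases d) auto
    have nd: "\<not> p dvd d" "\<not> p dvd e" using step.hyps(3) e by (auto intro: dvd_mult dvd_mult2)
    have "p ^ a * m = (p ^ i * d) * (p ^ (a - i) * e)"
      unfolding e using x(2) by (metis le_add_diff_inverse mult.assoc mult.left_commute power_add)
    moreover have "p ^ i * d \<noteq> 0" using step.hyps(1) d0 by auto
    ultimately have "p ^ a * m div (p ^ i * d) = p ^ (a - i) * e" by simp
    moreover have "m div d = e" using e d0 by simp
    moreover note nd
    ultimately show ?thesis using x step.hyps
      by (simp add: multf_prime_power_times[OF step.hyps(1)] c c')
  qed
  have "(\<Sum>d | d dvd p ^ a * m. multf c d * multf c' (p ^ a * m div d))
     = (\<Sum>x\<in>{..a} \<times> {d. d dvd m}. case x of (i, d) \<Rightarrow> multf c (p ^ i * d) * multf c' (p ^ a * m div (p ^ i * d)))"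
    by (subst sum.reindex_bij_betw[OF bij_betw_divisors_prime_power_times[OF step.hyps(1,3)], symmetric])
       (simp add: case_prod_unfold)
  also have "\<dots> = (\<Sum>x\<in>{..a} \<times> {d. d dvd m}. case x of (i, d) \<Rightarrow>
                   (c p i * c' p (a - i)) * (multf c d * multf c' (m div d)))"
    by (rule sum.cong[OF refl eq])
  also have "\<dots> = (\<Sum>i\<le>a. c p i * c' p (a - i)) * (\<Sum>d | d dvd m. multf c d * multf c' (m div d))"
    by (simp add: sum_product sum.cartesian_product)
  also have "\<dots> = multf (\<lambda>p a. \<Sum>i\<le>a. c p i * c' p (a - i)) (p ^ a * m)"
    using step by (subst multf_prime_power_times) (auto simp: c c')
  finally show ?case by simp
qed auto

text \<open>Complete multiplicativity of \<open>n powr s\<close> turns the weight into a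
  substitution in each local factor. With a negative exponent this makes Dirichlet series instances
  of the plain sums of \<open>multf\<close> studied below.\<close>

lemma multf_powr:
  assumes c: "\<And>q. c q 0 = 1"
  shows "multf (\<lambda>p a. c p a * (real p powr s) ^ a) n = multf c n * real n powr s"
proof (cases "n = 0")
  case False
  hence "n > 0" by simp
  thus ?thesis
  proof (induction n rule: prime_power_times_induct)
    case (step p a m)
    have "real (p ^ a * m) powr s = (real p powr s) ^ a * real m powr s"
      using step.hyps(1) by (simp add: powr_mult prime_gt_0_nat powr_powr powr_power mult.commute flip: powr_realpow)
    thus ?case using step
      by (simp add: multf_prime_power_times c)
  qed simp
qed simp

lemma multf_abs: "multf (\<lambda>p a. \<bar>c p a\<bar>) n = \<bar>multf c n\<bar>"
  by (simp add: multf_def abs_prod)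

section \<open>Euler products\<close>

text \<open>For real families, unconditional and absolute summability coincide; this supplies the
  joint summability that iterating the sum requires.\<close>

lemma has_sum_times_real:
  fixes f :: "'a \<Rightarrow> real" and g :: "'b \<Rightarrow> real"
  assumes f: "(f has_sum s) A" and g: "(g has_sum t) B"
  shows "((\<lambda>(x, y). f x * g y) has_sum (s * t)) (A \<times> B)"
proof (rule has_sum_SigmaI)
  show "((\<lambda>y. case (x, y) of (x, y) \<Rightarrow> f x * g y) has_sum (f x * t)) B" for x
    using has_sum_cmult_right[OF g] by simp
  show "((\<lambda>x. f x * t) has_sum (s * t)) A"
    by (rule has_sum_cmult_left[OF f])
  have "f summable_on A" "g summable_on B"
    using f g by (auto simp: summable_on_def)
  hence "(\<lambda>x. norm (f x)) summable_on A" "(\<lambda>x. norm (g x)) summable_on B"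
    using summable_on_iff_abs_summable_on_real by blast+
  moreover have "infsum (\<lambda>y. norm (f x * g y)) B = norm (f x) * infsum (\<lambda>y. norm (g y)) B" for x
    by (simp add: abs_mult infsum_cmult_right')
  ultimately have "(\<lambda>z. norm (case z of (x, y) \<Rightarrow> f x * g y)) summable_on (A \<times> B)"
    by (subst Infinite_Sum.abs_summable_on_Sigma_iff)
       (simp add: abs_mult summable_on_cmult_right summable_on_cmult_left)
  thus "(\<lambda>(x, y). f x * g y) summable_on (A \<times> B)"
    using summable_on_iff_abs_summable_on_real by blast
qed

lemma prime_factors_le:
  fixes n :: nat
  assumes "p \<in> prime_factors n" shows "p \<le> n"
proof -
  have "n > 0" using assms by (cases "n = 0") simp_all
  moreover have "p dvd n" using assms by (rule in_prime_factors_imp_dvd)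
  ultimately show ?thesis by (simp add: dvd_imp_le)
qed

text \<open>Unique factorisation: adding a prime \<open>p\<close> to \<open>S\<close> makes the new
  index set a copy of (exponent of \<open>p\<close>) times (old index set), on which
  \<open>multf c\<close> is a product of two summable families.\<close>

lemma multf_has_sum_finite_euler_product:
  fixes c :: "nat \<Rightarrow> nat \<Rightarrow> real"
  assumes "finite S" and "\<And>p. p \<in> S \<Longrightarrow> prime p" and c0: "\<And>q. c q 0 = 1"
    and "\<And>p. p \<in> S \<Longrightarrow> summable (\<lambda>a. \<bar>c p a\<bar>)"
  shows "(multf c has_sum (\<Prod>p\<in>S. \<Sum>a. c p a)) {n. n > 0 \<and> prime_factors n \<subseteq> S}"
  using assms(1,2,4)
proof (induction S rule: finite_induct)
  case empty
  have "{n::nat. n > 0 \<and> prime_factors n \<subseteq> {}} = {1}"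
    by (auto simp: prime_factorization_empty_iff)
  thus ?case using has_sum_finite[of "{1}" "multf c"] by simp
next
  case (insert p S)
  have p: "prime p" using insert by auto
  define N where "N = (\<lambda>S. {n::nat. n > 0 \<and> prime_factors n \<subseteq> S})"
  have nd: "\<not> p dvd m" if "m \<in> N S" for m
    using that insert.hyps p by (auto simp: N_def prime_factors_dvd)
  have IH: "(multf c has_sum (\<Prod>p\<in>S. \<Sum>a. c p a)) (N S)"
    unfolding N_def using insert by auto
  have "(c p has_sum (\<Sum>a. c p a)) UNIV"
    using insert.prems(2)[of p]
    by (intro norm_summable_imp_has_sum summable_sums) (simp_all add: summable_rabs_cancel)
  hence "((\<lambda>(a, m). c p a * multf c m) has_sum ((\<Sum>a. c p a) * (\<Prod>p\<in>S. \<Sum>a. c p a))) (UNIV \<times> N S)"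
    using IH by (rule has_sum_times_real)
  moreover have "(case x of (a, m) \<Rightarrow> c p a * multf c m) = multf c ((\<lambda>(a, m). p ^ a * m) x)"
    if "x \<in> UNIV \<times> N S" for x
    using that by (auto simp: multf_prime_power_times[OF p nd] c0)
  ultimately have "((\<lambda>x. multf c ((\<lambda>(a, m). p ^ a * m) x)) has_sum ((\<Sum>a. c p a) * (\<Prod>p\<in>S. \<Sum>a. c p a))) (UNIV \<times> N S)"
    by (subst (asm) has_sum_cong) auto
  moreover have bij: "bij_betw (\<lambda>(a, m). p ^ a * m) (UNIV \<times> N S) (N (insert p S))"
  proof (rule bij_betwI[of _ _ _ "\<lambda>n. (multiplicity p n, n div p ^ multiplicity p n)"])
    show "(\<lambda>(a, m). p ^ a * m) \<in> UNIV \<times> N S \<rightarrow> N (insert p S)"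
    proof (rule funcsetI)
      fix x :: "nat \<times> nat" assume "x \<in> UNIV \<times> N S"
      then obtain a m where x: "x = (a, m)" and m: "m \<in> N S" by blast
      hence "prime_factors (p ^ a * m) \<subseteq> insert p S"
        using p by (cases "a = 0") (auto simp: N_def prime_factors_product prime_factorization_prime_power)
      thus "(\<lambda>(a, m). p ^ a * m) x \<in> N (insert p S)" using m p x by (simp add: N_def prime_gt_0_nat)
    qed
  next
    show "(\<lambda>n. (multiplicity p n, n div p ^ multiplicity p n)) \<in> N (insert p S) \<rightarrow> UNIV \<times> N S"
    proof (rule funcsetI)
      fix n assume n: "n \<in> N (insert p S)"
      hence n0: "n \<noteq> 0" by (simp add: N_def)
      define m where "m = n div p ^ multiplicity p n"
      have nm: "n = p ^ multiplicity p n * m" unfolding m_def by (simp add: multiplicity_dvd)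
      hence m0: "m > 0" using n0 by (cases m) auto
      have "\<not> p dvd m" unfolding m_def by (rule multiplicity_decompose) (use n0 p in auto)
      hence "p \<notin> prime_factors m" by auto
      moreover have "prime_factors m \<subseteq> insert p S"
      proof -
        have "m dvd n" by (subst nm) simp
        hence "prime_factors m \<subseteq> prime_factors n" by (rule dvd_prime_factors[OF n0])
        thus ?thesis using n unfolding N_def by blast
      qed
      ultimately have "m \<in> N S" using m0 by (auto simp: N_def)
      thus "(multiplicity p n, n div p ^ multiplicity p n) \<in> UNIV \<times> N S" by (simp add: m_def)
    qed
  next
    fix x :: "nat \<times> nat" assume "x \<in> UNIV \<times> N S"
    then obtain a m where x: "x = (a, m)" "m \<in> N S" by auto
    have "m > 0" "\<not> p dvd m" using x nd by (auto simp: N_def)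
    hence "multiplicity p (p ^ a * m) = a"
      using p by (simp add: prime_elem_multiplicity_mult_distrib not_dvd_imp_multiplicity_0)
    thus "(multiplicity p ((\<lambda>(a, m). p ^ a * m) x), (\<lambda>(a, m). p ^ a * m) x div p ^ multiplicity p ((\<lambda>(a, m). p ^ a * m) x)) = x"
      using x p by (simp add: prime_gt_0_nat)
  next
    fix n show "(\<lambda>(a, m). p ^ a * m) (multiplicity p n, n div p ^ multiplicity p n) = n"
      by (simp add: multiplicity_dvd)
  qed
  ultimately have "(multf c has_sum ((\<Sum>a. c p a) * (\<Prod>p\<in>S. \<Sum>a. c p a))) (N (insert p S))"
    using has_sum_reindex_bij_betw[OF bij, of "multf c"] by blast
  thus ?case using insert by (simp add: N_def)
qed

text \<open>The term at index 0 is 1 in both series, so a bound on the excess of the absolute series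
  over 1 also bounds the distance of the signed one from 1.\<close>

lemma local_factor_bound:
  fixes f :: "nat \<Rightarrow> real"
  assumes "summable (\<lambda>a. \<bar>f a\<bar>)" "f 0 = 1" "(\<Sum>a. \<bar>f a\<bar>) \<le> 1 + b"
  shows "\<bar>(\<Sum>a. f a) - 1\<bar> \<le> b"
proof -
  have s: "summable (\<lambda>a. \<bar>f (Suc a)\<bar>)" using assms(1) by (subst summable_Suc_iff)
  have "(\<Sum>a. f a) = 1 + (\<Sum>a. f (Suc a))"
    using suminf_split_head[OF summable_rabs_cancel[OF assms(1)]] assms(2) by simp
  moreover have "(\<Sum>a. \<bar>f a\<bar>) = 1 + (\<Sum>a. \<bar>f (Suc a)\<bar>)"
    using suminf_split_head[OF assms(1)] assms(2) by simp
  moreover have "\<bar>\<Sum>a. f (Suc a)\<bar> \<le> (\<Sum>a. \<bar>f (Suc a)\<bar>)" by (rule summable_rabs[OF s])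
  ultimately show ?thesis using assms(3) by linarith
qed

context
  fixes c :: "nat \<Rightarrow> nat \<Rightarrow> real" and b :: "nat \<Rightarrow> real"
  assumes c0: "\<And>q. c q 0 = 1"
    and sumc: "\<And>p. prime p \<Longrightarrow> summable (\<lambda>a. \<bar>c p a\<bar>)"
    and bound: "\<And>p. prime p \<Longrightarrow> (\<Sum>a. \<bar>c p a\<bar>) \<le> 1 + b p"
    and b: "summable b" "\<And>n. b n \<ge> 0"
begin

text \<open>Every positive \<open>n < N\<close> has only prime factors below \<open>N\<close>, so
  the partial sum is at most the Euler product of the absolute local factors over those primes. Each
  factor is at most \<open>1 + b p \<le> exp (b p)\<close>, and the exponents sum to at most
  \<open>suminf b\<close>.\<close>

lemma multf_abs_summable: "summable (\<lambda>n. \<bar>multf c n\<bar>)"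
proof (rule summableI_nonneg_bounded[where x = "exp (suminf b)"])
  fix N :: nat
  define S where "S = {p. prime p \<and> p < N}"
  have fin: "finite S" unfolding S_def by (rule finite_subset[of _ "{..<N}"]) auto
  have "(multf (\<lambda>p a. \<bar>c p a\<bar>) has_sum (\<Prod>p\<in>S. \<Sum>a. \<bar>c p a\<bar>)) {n. n > 0 \<and> prime_factors n \<subseteq> S}"
    by (rule multf_has_sum_finite_euler_product) (use fin c0 sumc in \<open>auto simp: S_def\<close>)
  hence hs: "((\<lambda>n. \<bar>multf c n\<bar>) has_sum (\<Prod>p\<in>S. \<Sum>a. \<bar>c p a\<bar>)) {n. n > 0 \<and> prime_factors n \<subseteq> S}"
    by (simp add: multf_abs[abs_def])
  have "(\<Sum>n<N. \<bar>multf c n\<bar>) = (\<Sum>n\<in>{0<..<N}. \<bar>multf c n\<bar>)"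
    by (rule sum.mono_neutral_right) auto
  also have "\<dots> \<le> (\<Prod>p\<in>S. \<Sum>a. \<bar>c p a\<bar>)"
  proof (rule finite_sum_le_has_sum[OF hs])
    show "{0<..<N} \<subseteq> {n. n > 0 \<and> prime_factors n \<subseteq> S}"
      by (auto simp: S_def dest: prime_factors_le)
  qed auto
  also have "\<dots> \<le> (\<Prod>p\<in>S. exp (b p))"
  proof (rule prod_mono)
    fix p assume "p \<in> S"
    hence "prime p" by (simp add: S_def)
    thus "0 \<le> (\<Sum>a. \<bar>c p a\<bar>) \<and> (\<Sum>a. \<bar>c p a\<bar>) \<le> exp (b p)"
      using order.trans[OF bound[of p] exp_ge_add_one_self[of "b p"]] suminf_nonneg[OF sumc[of p]] by simp
  qed
  also have "\<dots> = exp (\<Sum>p\<in>S. b p)" using fin by (simp add: exp_sum)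
  also have "\<dots> \<le> exp (suminf b)" using sum_le_suminf[OF b(1) fin] b(2) by simp
  finally show "(\<Sum>n<N. \<bar>multf c n\<bar>) \<le> exp (suminf b)" .
qed auto

text \<open>The product over primes up to \<open>N\<close> misses only 0, where \<open>multf\<close>
  vanishes, and numbers with a prime factor above \<open>N\<close>. The latter exceed
  \<open>N\<close>, so the error is at most the tail \<open>R N\<close> of the absolute
  series.\<close>

lemma euler_product_LIMSEQ:
  "(\<lambda>N. \<Prod>p | prime p \<and> p \<le> N. \<Sum>a. c p a) \<longlonglongrightarrow> (\<Sum>n. multf c n)"
proof -
  define T where "T = (\<Sum>n. multf c n)"
  define P where "P = (\<lambda>N. \<Prod>p | prime p \<and> p \<le> N. \<Sum>a. c p a)"
  define R where "R = (\<lambda>N. (\<Sum>n. \<bar>multf c n\<bar>) - (\<Sum>n<Suc N. \<bar>multf c n\<bar>))"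
  have sm: "summable (multf c)" using multf_abs_summable by (rule summable_rabs_cancel)
  have total: "(multf c has_sum T) UNIV" unfolding T_def
    by (rule norm_summable_imp_has_sum) (use multf_abs_summable sm in auto)
  have atotal: "((\<lambda>n. \<bar>multf c n\<bar>) has_sum (\<Sum>n. \<bar>multf c n\<bar>)) UNIV"
    by (rule norm_summable_imp_has_sum) (use multf_abs_summable in auto)
  have "norm (P N - T) \<le> R N" for N
  proof -
    define A where "A = {n::nat. n > 0 \<and> prime_factors n \<subseteq> {p. prime p \<and> p \<le> N}}"
    have fin: "finite {p::nat. prime p \<and> p \<le> N}" by (rule finite_subset[of _ "{..N}"]) auto
    have "(multf c has_sum P N) A" unfolding P_def A_def
      by (rule multf_has_sum_finite_euler_product) (use fin c0 sumc in auto)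
    from has_sum_Diff[OF total this] have h1: "(multf c has_sum (T - P N)) (- A)"
      by (simp add: Compl_eq_Diff_UNIV)
    have "((\<lambda>n. \<bar>multf c n\<bar>) has_sum R N) (UNIV - {..<Suc N})" unfolding R_def
      by (rule has_sum_Diff[OF atotal has_sum_finite]) auto
    hence h2: "((\<lambda>n. \<bar>multf c n\<bar>) has_sum R N) {Suc N..}"
      by (simp add: Compl_eq_Diff_UNIV[symmetric] Compl_lessThan)
    have "(\<lambda>n. \<bar>multf c n\<bar>) summable_on (- A)"
      by (rule summable_on_subset_banach[of _ UNIV]) (use atotal in \<open>auto simp: summable_on_def\<close>)
    then obtain s where s: "((\<lambda>n. \<bar>multf c n\<bar>) has_sum s) (- A)"
      by (auto simp: summable_on_def)
    have sub: "{0<..N} \<subseteq> A"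
      by (auto simp: A_def dest: prime_factors_le)
    have "s \<le> R N"
    proof (rule has_sum_mono_neutral[OF s h2])
      fix n assume "n \<in> - A - {Suc N..}"
      hence "n \<notin> {0<..N}" "n \<le> N" using sub by (blast, simp)
      hence "n = 0" by simp
      thus "\<bar>multf c n\<bar> \<le> 0" by simp
    qed auto
    moreover have "norm (T - P N) \<le> s"
      by (rule norm_has_sum_bound[OF _ h1]) (use s in simp)
    ultimately show ?thesis by (simp add: norm_minus_commute)
  qed
  moreover have "R \<longlonglongrightarrow> 0"
  proof -
    have "(\<lambda>N. \<Sum>n<Suc N. \<bar>multf c n\<bar>) \<longlonglongrightarrow> (\<Sum>n. \<bar>multf c n\<bar>)"
      using summable_LIMSEQ[OF multf_abs_summable] by (rule LIMSEQ_Suc)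
    from tendsto_diff[OF tendsto_const[of "\<Sum>n. \<bar>multf c n\<bar>"] this] show ?thesis by (simp add: R_def)
  qed
  ultimately have "(\<lambda>N. P N - T) \<longlonglongrightarrow> 0"
    by (rule Lim_null_comparison[OF always_eventually[OF allI]])
  hence "P \<longlonglongrightarrow> T" by (rule LIM_zero_cancel)
  thus ?thesis unfolding P_def T_def .
qed

text \<open>The distances of the factors from 1 are summable, and such an infinite product vanishes
  only if one of its factors does.\<close>

lemma suminf_multf_nonzero:
  assumes nz: "\<And>p. prime p \<Longrightarrow> (\<Sum>a. c p a) \<noteq> 0"
  shows "(\<Sum>n. multf c n) \<noteq> 0"
proof -
  \<comment> \<open>Padding with 1 at non-primes gives a product indexed by all naturals.\<close>
  define f where "f = (\<lambda>p. if prime p then \<Sum>a. c p a else 1)"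
  have "summable (\<lambda>p. norm (f p - 1))"
    by (rule summable_comparison_test'[OF b(1), of 0])
       (use local_factor_bound[OF sumc c0 bound] b(2) in \<open>auto simp: f_def\<close>)
  hence cp: "convergent_prod f"
    by (intro abs_convergent_prod_imp_convergent_prod summable_imp_abs_convergent_prod)
  have "(\<Prod>n\<le>N. f n) = (\<Prod>p | prime p \<and> p \<le> N. \<Sum>a. c p a)" for N
  proof -
    have "(\<Prod>n\<le>N. f n) = (\<Prod>p | prime p \<and> p \<le> N. f p)"
      by (rule prod.mono_neutral_right) (auto simp: f_def)
    thus ?thesis by (simp add: f_def)
  qed
  hence "prodinf f = (\<Sum>n. multf c n)"
    using LIMSEQ_unique[OF convergent_prod_LIMSEQ[OF cp]] euler_product_LIMSEQ by simp
  moreover have "prodinf f \<noteq> 0"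
    by (rule prodinf_nonzero[OF cp]) (use nz in \<open>auto simp: f_def\<close>)
  ultimately show ?thesis by simp
qed

end

section \<open>Factorisations of Gaussian integers\<close>

lemma gauss_intE:
  assumes "z \<in> gauss_int"
  obtains a b :: int where "z = Complex (of_int a) (of_int b)"
  using assms unfolding gauss_int_def Ints_def by (auto simp: complex_eq_iff)

lemma gauss_int_Complex [simp]: "Complex (of_int a) (of_int b) \<in> gauss_int"
  by (simp add: gauss_int_def)

lemma gauss_int_mult: "z \<in> gauss_int \<Longrightarrow> w \<in> gauss_int \<Longrightarrow> z * w \<in> gauss_int"
  by (simp add: gauss_int_def)

lemma gauss_int_power: "z \<in> gauss_int \<Longrightarrow> z ^ n \<in> gauss_int"
  by (induction n) (auto intro: gauss_int_mult, simp add: gauss_int_def)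

lemma gauss_int_prod_list: "(\<And>z. z \<in> set zs \<Longrightarrow> z \<in> gauss_int) \<Longrightarrow> prod_list zs \<in> gauss_int"
  by (induction zs) (auto intro: gauss_int_mult, simp add: gauss_int_def)

lemma gauss_int_normE:
  assumes "z \<in> gauss_int"
  obtains n :: nat where "(cmod z)\<^sup>2 = real n"
proof -
  obtain a b where z: "z = Complex (of_int a) (of_int b)" using assms by (rule gauss_intE)
  have "(cmod z)\<^sup>2 = of_int (a\<^sup>2 + b\<^sup>2)" by (simp add: z cmod_power2)
  also have "\<dots> = real (nat (a\<^sup>2 + b\<^sup>2))" by simp
  finally show ?thesis by (rule that)
qed

lemma cmod_gauss_int_ge_1:
  assumes "z \<in> gauss_int" "z \<noteq> 0" shows "cmod z \<ge> 1"
proof -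
  obtain n where n: "(cmod z)\<^sup>2 = real n" using assms(1) by (rule gauss_int_normE)
  have "n \<noteq> 0" using n assms(2) by (cases "n = 0") auto
  hence "(cmod z)\<^sup>2 \<ge> 1\<^sup>2" using n by simp
  thus ?thesis by (rule power2_le_imp_le) simp
qed

lemma gassoc_refl: "gassoc z z"
  by (simp add: gassoc_def)

lemma gassoc_sym: "gassoc z w \<Longrightarrow> gassoc w z"
  unfolding gassoc_def by (auto simp flip: mult.assoc)

lemma gassoc_trans: "gassoc z w \<Longrightarrow> gassoc w v \<Longrightarrow> gassoc z v"
  unfolding gassoc_def by (auto simp flip: mult.assoc)

lemma gassoc_cmod: "gassoc z w \<Longrightarrow> cmod w = cmod z"
  unfolding gassoc_def by (auto simp: norm_mult)

lemma gclass_eq_iff: "gclass z = gclass w \<longleftrightarrow> gassoc z w"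
  unfolding gclass_def set_eq_iff using gassoc_refl gassoc_sym gassoc_trans by (metis mem_Collect_eq)

text \<open>The prime 2 ramifies: \<open>1 + \<i>\<close> is the only Gaussian prime above it, up to
  units. An even norm forces \<open>a + b\<close> to be even, which is divisibility by
  \<open>1 + \<i>\<close>; norm 1 leaves only the four units.\<close>

lemma gassoc_power_1_plus_ii:
  assumes "z \<in> gauss_int" "(cmod z)\<^sup>2 = 2 ^ e"
  shows "gassoc ((1 + \<i>) ^ e) z"
  using assms
proof (induction e arbitrary: z)
  case 0
  obtain a b where z: "z = Complex (of_int a) (of_int b)" using 0(1) by (rule gauss_intE)
  have "of_int (a\<^sup>2 + b\<^sup>2) = (1::real)" using 0(2) by (simp add: z cmod_power2)
  hence 1: "a\<^sup>2 + b\<^sup>2 = 1" by (simp only: of_int_eq_1_iff)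
  have "\<bar>a\<bar> \<le> 1" "\<bar>b\<bar> \<le> 1"
    unfolding abs_square_le_1[symmetric]
    using 1 zero_le_power2[of a] zero_le_power2[of b] by linarith+
  hence "a \<in> {-1, 0, 1}" "b \<in> {-1, 0, 1}" by auto
  hence "z \<in> {1, -1, \<i>, -\<i>}" using 1 by (auto simp: z complex_eq_iff)
  thus ?case by (simp add: gassoc_def)
next
  case (Suc e)
  obtain a b where z: "z = Complex (of_int a) (of_int b)" using Suc(2) by (rule gauss_intE)
  have "real_of_int (a\<^sup>2 + b\<^sup>2) = real_of_int (2 ^ Suc e)" using Suc(3) by (simp add: z cmod_power2)
  hence eq: "a\<^sup>2 + b\<^sup>2 = 2 ^ Suc e" by (simp only: of_int_eq_iff)
  hence "even (a\<^sup>2 + b\<^sup>2)" by simp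
  hence "even (a + b)" by simp
  then obtain x where x: "a + b = 2 * x" by (elim evenE)
  \<comment> \<open>This is the quotient \<open>z / (1 + \<i>)\<close>, whose coordinates are
    \<open>(a + b) / 2\<close> and \<open>(b - a) / 2\<close>.\<close>
  define w where "w = Complex (of_int x) (of_int (b - x))"
  have a: "a = 2 * x - b" using x by simp
  have zw: "z = (1 + \<i>) * w" by (simp add: z w_def complex_eq_iff a)
  have "(cmod z)\<^sup>2 = 2 * (cmod w)\<^sup>2" by (simp add: zw norm_mult power_mult_distrib) (simp add: cmod_def)
  hence "(cmod w)\<^sup>2 = 2 ^ e" using Suc(3) by simp
  hence "gassoc ((1 + \<i>) ^ e) w" by (intro Suc.IH) (auto simp: w_def simp del: of_int_diff)
  thus ?case by (auto simp: gassoc_def zw mult_ac)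
qed

text \<open>Norms are natural numbers and multiplicative, and divisors of a power of 2 are powers of
  2.\<close>

lemma norms_of_factors_power_of_2:
  assumes "\<And>z. z \<in> set zs \<Longrightarrow> z \<in> gauss_int" "(cmod (prod_list zs))\<^sup>2 = 2 ^ N"
  shows "\<exists>es. sum_list es = N \<and> list_all2 (\<lambda>z e. (cmod z)\<^sup>2 = 2 ^ e) zs es"
  using assms
proof (induction zs arbitrary: N)
  case (Cons z zs)
  obtain n where n: "(cmod z)\<^sup>2 = real n" using Cons.prems(1)[of z] by (auto elim: gauss_int_normE)
  obtain m where m: "(cmod (prod_list zs))\<^sup>2 = real m"
    using gauss_int_prod_list[of zs] Cons.prems(1) by (auto elim: gauss_int_normE)
  have "real (n * m) = real (2 ^ N)"
    using Cons.prems(2) by (simp add: norm_mult power_mult_distrib n m)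
  hence nm: "n * m = 2 ^ N" by (simp only: of_nat_eq_iff)
  hence "n dvd 2 ^ N" by (metis dvd_triv_left)
  then obtain e where e: "e \<le> N" "n = 2 ^ e" using divides_primepow_nat[of 2 n N] by auto
  have "2 ^ e * m = 2 ^ e * 2 ^ (N - e)" using nm e by (simp flip: power_add)
  hence "m = 2 ^ (N - e)" by simp
  hence "(cmod (prod_list zs))\<^sup>2 = 2 ^ (N - e)" using m by simp
  then obtain es where "sum_list es = N - e" "list_all2 (\<lambda>z e. (cmod z)\<^sup>2 = 2 ^ e) zs es"
    using Cons.IH[of "N - e"] Cons.prems(1) by auto
  thus ?case using e n by (intro exI[of _ "e # es"]) auto
next
  case Nil
  hence "N = 0" using one_less_power[of "2::real" N] by (cases "N = 0") simp_all
  thus ?case by simp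
qed

text \<open>Since \<open>2 ^ j\<close> is associated to \<open>(1 + \<i>) ^ (2 * j)\<close>, a
  factorisation is determined by its \<open>k\<close> exponents of \<open>1 + \<i>\<close>, which
  sum to \<open>2 * j\<close>; these are counted by stars and bars. The cases \<open>j = 0\<close>
  and \<open>j = 1\<close> yield the first two coefficients of the local series.\<close>

lemma gt_power_of_2: "gt k (2 ^ j) = (2 * j + k - 1) choose (2 * j)"
proof -
  define L where "L = {es::nat list. length es = k \<and> sum_list es = 2 * j}"
  define f where "f = map (\<lambda>e. gclass ((1 + \<i>) ^ e))"
  define X where "X = {cs. \<exists>zs. length zs = k \<and> (\<forall>z\<in>set zs. z \<in> gauss_int \<and> z \<noteq> 0)
                 \<and> gassoc (prod_list zs) (of_nat (2 ^ j)) \<and> cs = map gclass zs}"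
  have cmod: "(cmod (1 + \<i>))\<^sup>2 = 2" by (simp add: cmod_def)
  have cmod_of_nat: "(cmod (of_nat (2 ^ j)))\<^sup>2 = 2 ^ (2 * j)" by (simp add: norm_power power_mult mult.commute)
  \<comment> \<open>The norm of \<open>(1 + \<i>) ^ e\<close> is \<open>2 ^ e\<close>, so different
    exponents give different classes.\<close>
  have "inj_on f L"
  proof -
    have "inj (\<lambda>e. gclass ((1 + \<i>) ^ e))"
    proof (rule injI)
      fix e e' assume "gclass ((1 + \<i>) ^ e) = gclass ((1 + \<i>) ^ e')"
      hence "(cmod ((1 + \<i>) ^ e'))\<^sup>2 = (cmod ((1 + \<i>) ^ e))\<^sup>2"
        using gassoc_cmod by (simp add: gclass_eq_iff)
      hence "((cmod (1 + \<i>))\<^sup>2) ^ e' = ((cmod (1 + \<i>))\<^sup>2) ^ e"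
        by (simp add: norm_power power_mult[symmetric] mult.commute)
      thus "e = e'" by (simp add: cmod)
    qed
    thus ?thesis unfolding f_def by (rule inj_on_subset[OF inj_mapI]) auto
  qed
  moreover have "f ` L = X"
  proof (intro equalityI subsetI)
    fix cs assume "cs \<in> f ` L"
    then obtain es where es: "length es = k" "sum_list es = 2 * j" "cs = f es" by (auto simp: L_def)
    have "prod_list (map (\<lambda>e. (1 + \<i>) ^ e) es) = (1 + \<i>) ^ sum_list es"
      by (induction es) (auto simp: power_add)
    moreover have "gassoc ((1 + \<i>) ^ (2 * j)) (of_nat (2 ^ j))"
      using cmod_of_nat by (intro gassoc_power_1_plus_ii) (simp_all add: gauss_int_def)
    moreover have "(1 + \<i>) ^ e \<in> gauss_int" for e
      by (intro gauss_int_power) (simp add: gauss_int_def)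
    moreover have "1 + \<i> \<noteq> 0" by (simp add: complex_eq_iff)
    ultimately show "cs \<in> X" using es
      by (auto simp: X_def f_def intro!: exI[of _ "map (\<lambda>e. (1 + \<i>) ^ e) es"])
  next
    fix cs assume "cs \<in> X"
    then obtain zs where zs: "length zs = k" "\<forall>z\<in>set zs. z \<in> gauss_int \<and> z \<noteq> 0"
      "gassoc (prod_list zs) (of_nat (2 ^ j))" "cs = map gclass zs" by (auto simp: X_def)
    have "(cmod (prod_list zs))\<^sup>2 = 2 ^ (2 * j)"
      using gassoc_cmod[OF zs(3)] cmod_of_nat by metis
    then obtain es where es: "sum_list es = 2 * j" "list_all2 (\<lambda>z e. (cmod z)\<^sup>2 = 2 ^ e) zs es"
      using norms_of_factors_power_of_2 zs(2) by blast
    have len: "length es = k" using es(2) zs(1) list_all2_lengthD by metis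
    have "map gclass zs = f es"
    proof (rule nth_equalityI)
      fix i assume i: "i < length (map gclass zs)"
      hence "(cmod (zs ! i))\<^sup>2 = 2 ^ (es ! i)" using es(2) by (auto simp: list_all2_conv_all_nth)
      hence "gassoc ((1 + \<i>) ^ (es ! i)) (zs ! i)"
        using i zs(2) by (intro gassoc_power_1_plus_ii) auto
      thus "map gclass zs ! i = f es ! i"
        using i len zs(1) gassoc_sym by (simp add: f_def gclass_eq_iff)
    qed (use len zs(1) in \<open>simp add: f_def\<close>)
    thus "cs \<in> f ` L" using zs(4) es(1) len by (auto simp: L_def)
  qed
  ultimately have "card X = card L" using card_image by metis
  thus ?thesis by (simp add: gt_def X_def L_def card_length_sum_list)
qed

text \<open>All remaining factors have modulus at least 1.\<close>

lemma cmod_le_cmod_prod_list: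
  assumes "\<forall>z\<in>set zs. z \<in> gauss_int \<and> z \<noteq> 0" "z \<in> set zs"
  shows "cmod z \<le> cmod (prod_list zs)"
  using assms
proof (induction zs)
  case (Cons y zs)
  have 1: "cmod y \<ge> 1" using Cons.prems cmod_gauss_int_ge_1 by auto
  have 2: "cmod (prod_list zs) \<ge> 1"
    using Cons.prems by (intro cmod_gauss_int_ge_1 gauss_int_prod_list) (auto simp: prod_list_zero_iff)
  show ?case
  proof (cases "z = y")
    case True
    thus ?thesis using mult_left_mono[OF 2, of "cmod y"] by (simp add: norm_mult)
  next
    case False
    hence "cmod z \<le> cmod (prod_list zs)" using Cons by auto
    also have "\<dots> \<le> cmod y * cmod (prod_list zs)"
      using mult_right_mono[OF 1, of "cmod (prod_list zs)"] by simp
    finally show ?thesis by (simp add: norm_mult)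
  qed
qed auto

text \<open>Each factor has modulus at most \<open>a\<close>, so both of its coordinates lie in
  \<open>{- int a..int a}\<close>. This crude bound is polynomial in \<open>a\<close> for fixed
  \<open>k\<close>, which is enough for radius of convergence at least 1.\<close>

lemma gt_le: "gt k a \<le> (2 * a + 1) ^ (2 * k)"
proof -
  define B where "B = (\<lambda>(x, y). Complex (of_int x) (of_int y)) ` ({- int a..int a} \<times> {- int a..int a})"
  have finB: "finite B" by (simp add: B_def)
  have "card B \<le> card ({- int a..int a} \<times> {- int a..int a})" unfolding B_def by (rule card_image_le) simp
  also have "\<dots> = (2 * a + 1)\<^sup>2"
  proof -
    have "nat (int a + 1 + int a) = 2 * a + 1" by simp
    thus ?thesis by (simp add: card_cartesian_product power2_eq_square)
  qed
  finally have cardB: "card B \<le> (2 * a + 1)\<^sup>2" .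
  have "{cs. \<exists>zs. length zs = k \<and> (\<forall>z\<in>set zs. z \<in> gauss_int \<and> z \<noteq> 0)
                 \<and> gassoc (prod_list zs) (of_nat a) \<and> cs = map gclass zs}
        \<subseteq> map gclass ` {zs. set zs \<subseteq> B \<and> length zs = k}" (is "?X \<subseteq> ?Y")
  proof
    fix cs assume "cs \<in> ?X"
    then obtain zs where zs: "length zs = k" "\<forall>z\<in>set zs. z \<in> gauss_int \<and> z \<noteq> 0"
      "gassoc (prod_list zs) (of_nat a)" "cs = map gclass zs" by auto
    have "z \<in> B" if z: "z \<in> set zs" for z
    proof -
      obtain x y where xy: "z = Complex (of_int x) (of_int y)" using z zs(2) gauss_intE by blast
      have "cmod z \<le> real a"
        using cmod_le_cmod_prod_list[OF zs(2) z] gassoc_cmod[OF zs(3)] by simp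
      hence "\<bar>of_int x\<bar> \<le> real a" "\<bar>of_int y\<bar> \<le> real a"
        using abs_Re_le_cmod[of z] abs_Im_le_cmod[of z] by (simp_all add: xy)
      hence "x \<in> {- int a..int a}" "y \<in> {- int a..int a}" by auto
      thus ?thesis unfolding B_def xy by auto
    qed
    thus "cs \<in> ?Y" using zs by auto
  qed
  hence "card ?X \<le> card ?Y" by (intro card_mono finite_imageI finite_lists_length_eq finB)
  also have "\<dots> \<le> card {zs. set zs \<subseteq> B \<and> length zs = k}"
    by (intro card_image_le finite_lists_length_eq finB)
  also have "\<dots> = card B ^ k" by (rule card_lists_length_eq[OF finB])
  also have "\<dots> \<le> ((2 * a + 1)\<^sup>2) ^ k" by (rule power_mono[OF cardB]) simp
  finally show ?thesis by (simp add: gt_def power_mult)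
qed

section \<open>Summatory functions\<close>

abbreviation mf :: "real fps \<Rightarrow> nat \<Rightarrow> real" where
  "mf f \<equiv> multf (\<lambda>_. fps_nth f)"

definition msum :: "real fps \<Rightarrow> real \<Rightarrow> real" where
  "msum f x = (\<Sum>n\<in>{1..nat \<lfloor>x\<rfloor>}. mf f n)"

lemma mf_mult:
  assumes "fps_nth f 0 = 1" "fps_nth g 0 = 1" "n > 0"
  shows "mf (f * g) n = (\<Sum>d | d dvd n. mf f d * mf g (n div d))"
  using multf_conv[of "\<lambda>_. fps_nth f" "\<lambda>_. fps_nth g" n] assms
  by (simp add: fps_mult_nth[abs_def] atLeast0AtMost)

lemma sum_divisor_conv:
  fixes a b :: "nat \<Rightarrow> real"
  shows "(\<Sum>n\<in>{1..N}. \<Sum>d | d dvd n. a d * b (n div d)) = (\<Sum>d\<in>{1..N}. a d * (\<Sum>m\<in>{1..N div d}. b m))"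
proof -
  have "(\<Sum>n\<in>{1..N}. \<Sum>d | d dvd n. a d * b (n div d))
      = (\<Sum>(n, d)\<in>(SIGMA n:{1..N}. {d. d dvd n}). a d * b (n div d))"
    by (rule sum.Sigma) (auto intro: finite_divisors_nat)
  also have "\<dots> = (\<Sum>(d, m)\<in>(SIGMA d:{1..N}. {1..N div d}). a d * b m)"
  proof (rule sum.reindex_bij_witness[of _ "\<lambda>(d, m). (d * m, d)" "\<lambda>(n, d). (d, n div d)"], goal_cases)
    case (2 z)
    then obtain y q where "z = (y * q, y)" "y * q \<le> N" "0 < y" "0 < q" by (auto simp: dvd_def)
    moreover have "y \<le> y * q" using \<open>0 < q\<close> by simp
    hence "y \<le> N" using \<open>y * q \<le> N\<close> by (rule order.trans)
    ultimately show ?case by (auto simp: Suc_le_eq div_le_mono less_eq_div_iff_mult_less_eq mult.commute)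
  next
    case (4 z)
    thus ?case by (auto simp: less_eq_div_iff_mult_less_eq mult.commute)
  qed auto
  also have "\<dots> = (\<Sum>d\<in>{1..N}. \<Sum>m\<in>{1..N div d}. a d * b m)"
    by (rule sum.Sigma[symmetric]) auto
  finally show ?thesis by (simp add: sum_distrib_left)
qed

lemma nat_floor_divide: "nat \<lfloor>x / real d\<rfloor> = nat \<lfloor>x\<rfloor> div d"
proof (cases "x \<ge> 0")
  case True
  thus ?thesis using floor_divide_real_eq_div[of "int d" x] by (simp add: nat_div_distrib)
next
  case False
  hence "x / real d \<le> 0" by (simp add: divide_nonpos_nonneg)
  thus ?thesis using False by simp
qed

lemma msum_mult:
  assumes "fps_nth f 0 = 1" "fps_nth g 0 = 1"
  shows "msum (f * g) x = (\<Sum>d\<in>{1..nat \<lfloor>x\<rfloor>}. mf f d * msum g (x / d))"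
  unfolding msum_def nat_floor_divide
  by (subst sum_divisor_conv[symmetric]) (simp add: mf_mult assms)

lemma msum_eq_0: "x < 1 \<Longrightarrow> msum f x = 0"
  by (simp add: msum_def)

section \<open>Euler factors of zeta(s) and zeta(2s) at X = p^-s, and convolution with the indicator
  of squares\<close>

definition geom1 :: "real fps" where "geom1 = Abs_fps (\<lambda>_. 1)"
definition geom2 :: "real fps" where "geom2 = Abs_fps (\<lambda>n. if even n then 1 else 0)"

lemma geom1: "(1 - fps_X) * geom1 = 1"
  by (rule fps_ext) (simp add: geom1_def algebra_simps)

lemma geom2: "(1 - fps_X ^ 2) * geom2 = 1"
proof (rule fps_ext)
  fix n
  have "((1 - fps_X ^ 2) * geom2) $ n = geom2 $ n - (fps_X ^ 2 * geom2) $ n" by (simp add: algebra_simps)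
  also have "\<dots> = 1 $ n" by (auto simp: geom2_def fps_X_power_mult_nth less_2_cases_iff)
  finally show "((1 - fps_X ^ 2) * geom2) $ n = 1 $ n" .
qed

lemma mf_geom1: "n > 0 \<Longrightarrow> mf geom1 n = 1"
  by (simp add: multf_def geom1_def)

lemma is_square_iff_even_multiplicity:
  assumes "n > (0 :: nat)"
  shows "(\<exists>m. n = m\<^sup>2) \<longleftrightarrow> (\<forall>p\<in>prime_factors n. even (multiplicity p n))"
proof -
  have "(\<exists>m. n = m\<^sup>2) \<longleftrightarrow> (\<forall>p. prime p \<longrightarrow> even (multiplicity p n))"
    using assms is_nth_power_conv_multiplicity_nat[of 2 n] by (simp add: is_nth_power_def)
  also have "\<dots> \<longleftrightarrow> (\<forall>p\<in>prime_factors n. even (multiplicity p n))"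
  proof (intro iffI ballI allI impI)
    fix p :: nat assume "\<forall>p\<in>prime_factors n. even (multiplicity p n)" "prime p"
    thus "even (multiplicity p n)" by (cases "multiplicity p n = 0") (simp_all add: prime_factors_multiplicity)
  qed auto
  finally show ?thesis .
qed

lemma mf_geom2:
  assumes "n > 0"
  shows "mf geom2 n = (if \<exists>m. n = m\<^sup>2 then 1 else 0)"
proof (cases "\<forall>p\<in>prime_factors n. even (multiplicity p n)")
  case True
  thus ?thesis using assms is_square_iff_even_multiplicity[OF assms] by (simp add: multf_def geom2_def)
next
  case False
  thus ?thesis using assms is_square_iff_even_multiplicity[OF assms] by (auto simp: multf_def geom2_def)
qed

text \<open>\<open>mf geom2\<close> is the indicator of the squares, so only
  \<open>d = e\<^sup>2\<close> survives in the convolution.\<close>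

lemma msum_geom2_mult:
  assumes "fps_nth f 0 = 1"
  shows "msum (geom2 * f) x = (\<Sum>e\<in>{1..nat \<lfloor>x\<rfloor>}. msum f (x / e\<^sup>2))"
proof -
  define N where "N = nat \<lfloor>x\<rfloor>"
  have N: "x < real N + 1" unfolding N_def by linarith
  have "msum (geom2 * f) x = (\<Sum>d\<in>{1..N}. mf geom2 d * msum f (x / d))"
    unfolding N_def by (rule msum_mult) (use assms in \<open>simp_all add: geom2_def\<close>)
  also have "\<dots> = (\<Sum>d\<in>{1..N}. if \<exists>m. d = m\<^sup>2 then msum f (x / d) else 0)"
    by (rule sum.cong) (simp_all add: mf_geom2)
  also have "\<dots> = (\<Sum>d\<in>{d\<in>{1..N}. \<exists>m. d = m\<^sup>2}. msum f (x / d))"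
    by (rule sum.inter_filter[symmetric]) simp
  also have "\<dots> = (\<Sum>e\<in>{e\<in>{1..N}. e\<^sup>2 \<le> N}. msum f (x / e\<^sup>2))"
  proof (rule sum.reindex_bij_betw[of "\<lambda>e. e\<^sup>2", symmetric, where g = "\<lambda>d. msum f (x / real d)", simplified of_nat_power])
    have inj: "inj_on (\<lambda>e. e\<^sup>2) {e \<in> {1..N}. e\<^sup>2 \<le> N}"
      by (rule inj_onI) simp
    have "(\<lambda>e. e\<^sup>2) ` {e \<in> {1..N}. e\<^sup>2 \<le> N} = {d \<in> {1..N}. \<exists>m. d = m\<^sup>2}"
    proof (intro equalityI subsetI)
      fix d assume "d \<in> {d \<in> {1..N}. \<exists>m. d = m\<^sup>2}"
      then obtain m where m: "d = m\<^sup>2" "1 \<le> m\<^sup>2" "m\<^sup>2 \<le> N" by auto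
      have "m \<ge> 1" using m(2) by (cases m) simp_all
      hence "m \<le> m\<^sup>2" by (simp add: power2_eq_square)
      hence "m \<le> N" using m(3) by (rule order.trans)
      thus "d \<in> (\<lambda>e. e\<^sup>2) ` {e \<in> {1..N}. e\<^sup>2 \<le> N}" using m \<open>m \<ge> 1\<close> by (intro image_eqI[of _ _ m]) simp_all
    qed auto
    with inj show "bij_betw (\<lambda>e. e\<^sup>2) {e \<in> {1..N}. e\<^sup>2 \<le> N} {d \<in> {1..N}. \<exists>m. d = m\<^sup>2}"
      unfolding bij_betw_def by (rule conjI)
  qed
  also have "\<dots> = (\<Sum>e\<in>{1..N}. msum f (x / e\<^sup>2))"
    \<comment> \<open>Terms with \<open>e\<^sup>2 > N\<close> vanish because then
      \<open>x / e\<^sup>2 < 1\<close>. The enlarged range is the one in the recursion for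
      \<open>Dlists\<close>.\<close>
    unfolding of_nat_power
  proof (rule sum.mono_neutral_left)
    show "\<forall>e\<in>{1..N} - {e \<in> {1..N}. e\<^sup>2 \<le> N}. msum f (x / (real e)\<^sup>2) = 0"
    proof
      fix e assume "e \<in> {1..N} - {e \<in> {1..N}. e\<^sup>2 \<le> N}"
      hence "e \<ge> 1" "N + 1 \<le> e\<^sup>2" by auto
      hence "real (N + 1) \<le> real (e\<^sup>2)" by (simp only: of_nat_le_iff)
      hence "x / (real e)\<^sup>2 < 1" using N \<open>e \<ge> 1\<close> by (simp add: divide_less_eq)
      thus "msum f (x / (real e)\<^sup>2) = 0" by (rule msum_eq_0)
    qed
  qed auto
  finally show ?thesis by (simp add: N_def)
qed

section \<open>Lattice points counted by \<open>Dcount\<close> as a summatory function\<close>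

definition Dlists :: "nat \<Rightarrow> real \<Rightarrow> nat list set" where
  "Dlists l x = {d :: nat list. length d = l + 1 \<and> (\<forall>i\<in>set d. i \<ge> 1)
      \<and> real (d ! 0 * (\<Prod>i\<in>{1..l}. (d ! i)^2)) \<le> x}"

lemma Dlists_0: "Dlists 0 x = (\<lambda>n. [n]) ` {1..nat \<lfloor>x\<rfloor>}"
proof -
  have "Suc 0 \<le> n \<Longrightarrow> n \<le> nat \<lfloor>x\<rfloor> \<longleftrightarrow> real n \<le> x" for n by linarith
  thus ?thesis by (auto simp: Dlists_def length_Suc_conv)
qed

text \<open>Dropping the last coordinate \<open>e\<close> divides the bound by
  \<open>e\<^sup>2\<close>. The condition that \<open>e\<close> is at most \<open>x\<close> is
  automatic, since the remaining product \<open>P\<close> is at least 1 and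
  \<open>e \<le> e\<^sup>2\<close>.\<close>

lemma append_in_Dlists_iff:
  "d @ [e] \<in> Dlists (Suc l) x \<longleftrightarrow> e \<in> {1..nat \<lfloor>x\<rfloor>} \<and> d \<in> Dlists l (x / e\<^sup>2)"
proof (cases "length d = Suc l \<and> (\<forall>i\<in>set d. i \<ge> 1) \<and> e \<ge> 1")
  case True
  define P where "P = d ! 0 * (\<Prod>i\<in>{1..l}. (d ! i)\<^sup>2)"
  have P1: "P \<ge> 1"
  proof -
    have "d ! i \<ge> 1" if "i \<le> l" for i using True that by auto
    hence "P \<noteq> 0" unfolding P_def by (force simp: prod_zero_iff)
    thus ?thesis by simp
  qed
  have prod: "(d @ [e]) ! 0 * (\<Prod>i\<in>{1..Suc l}. ((d @ [e]) ! i)\<^sup>2) = P * e\<^sup>2"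
  proof -
    have "(\<Prod>i\<in>{1..l}. ((d @ [e]) ! i)\<^sup>2) = (\<Prod>i\<in>{1..l}. (d ! i)\<^sup>2)"
      by (rule prod.cong) (use True in \<open>auto simp: nth_append\<close>)
    thus ?thesis using True by (simp add: P_def nth_append)
  qed
  have "real e \<le> x" if "real (P * e\<^sup>2) \<le> x"
  proof -
    have "1 * e \<le> P * e\<^sup>2" using P1 by (intro mult_mono) (auto simp: power2_eq_square)
    hence "real e \<le> real (P * e\<^sup>2)" by (simp only: of_nat_le_iff mult_1)
    thus ?thesis using that by linarith
  qed
  moreover have "real (P * e\<^sup>2) \<le> x \<longleftrightarrow> real P \<le> x / e\<^sup>2"
    using True by (simp add: le_divide_eq)
  ultimately have iff: "real (P * e\<^sup>2) \<le> x \<longleftrightarrow> e \<in> {1..nat \<lfloor>x\<rfloor>} \<and> real P \<le> x / e\<^sup>2"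
    using True by (auto simp: le_nat_iff le_floor_iff)
  have "d @ [e] \<in> Dlists (Suc l) x \<longleftrightarrow> real (P * e\<^sup>2) \<le> x"
    unfolding Dlists_def prod[symmetric] using True by auto
  moreover have "d \<in> Dlists l (x / e\<^sup>2) \<longleftrightarrow> real P \<le> x / e\<^sup>2"
    unfolding Dlists_def P_def using True by simp
  ultimately show ?thesis using iff by simp
qed (auto simp: Dlists_def)

lemma Dlists_Suc:
  "bij_betw (\<lambda>(e, d). d @ [e]) (SIGMA e:{1..nat \<lfloor>x\<rfloor>}. Dlists l (x / e\<^sup>2)) (Dlists (Suc l) x)"
proof -
  have "c \<in> (\<lambda>(e, d). d @ [e]) ` (SIGMA e:{1..nat \<lfloor>x\<rfloor>}. Dlists l (x / e\<^sup>2))" if "c \<in> Dlists (Suc l) x" for c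
  proof -
    have "c \<noteq> []" using that by (auto simp: Dlists_def)
    then obtain d e where c: "c = d @ [e]" by (cases c rule: rev_cases) auto
    hence "e \<in> {1..nat \<lfloor>x\<rfloor>} \<and> d \<in> Dlists l (x / e\<^sup>2)" using that append_in_Dlists_iff by blast
    hence "(e, d) \<in> (SIGMA e:{1..nat \<lfloor>x\<rfloor>}. Dlists l (x / e\<^sup>2))" by simp
    thus ?thesis unfolding c by (rule rev_image_eqI) simp
  qed
  moreover have "(\<lambda>(e, d). d @ [e]) z \<in> Dlists (Suc l) x"
    if "z \<in> (SIGMA e:{1..nat \<lfloor>x\<rfloor>}. Dlists l (x / e\<^sup>2))" for z
    using that by (cases z) (simp add: append_in_Dlists_iff)
  ultimately show ?thesis unfolding bij_betw_def by (intro conjI) (auto simp: inj_on_def)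
qed

lemma finite_Dlists: "finite (Dlists l x)"
proof (induction l arbitrary: x)
  case (Suc l)
  show ?case using bij_betw_finite[OF Dlists_Suc[where x = x and l = l]] Suc by simp
qed (simp add: Dlists_0)

lemma Dcount_eq_card: "Dcount l x = card (Dlists l x)"
  by (simp add: Dcount_def Dlists_def)

text \<open>Adding a squared coordinate obeys the same recursion as multiplying the series by
  \<open>geom2\<close>, namely summation over \<open>x / e\<^sup>2\<close>.\<close>

lemma Dcount_conv: "real (Dcount l x) = msum (geom1 * geom2 ^ l) x"
proof (induction l arbitrary: x)
  case 0
  have "Dcount 0 x = card (Dlists 0 x)" by (rule Dcount_eq_card)
  also have "\<dots> = nat \<lfloor>x\<rfloor>" unfolding Dlists_0 by (subst card_image) (auto simp: inj_on_def)
  finally show ?case by (simp add: msum_def mf_geom1)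
next
  case (Suc l)
  have "Dcount (Suc l) x = card (Dlists (Suc l) x)" by (rule Dcount_eq_card)
  also have "\<dots> = card (SIGMA e:{1..nat \<lfloor>x\<rfloor>}. Dlists l (x / e\<^sup>2))"
    using bij_betw_same_card[OF Dlists_Suc] by simp
  also have "\<dots> = (\<Sum>e\<in>{1..nat \<lfloor>x\<rfloor>}. Dcount l (x / e\<^sup>2))"
    by (subst card_SigmaI) (simp_all add: finite_Dlists Dcount_eq_card)
  finally have "real (Dcount (Suc l) x) = (\<Sum>e\<in>{1..nat \<lfloor>x\<rfloor>}. msum (geom1 * geom2 ^ l) (x / e\<^sup>2))"
    by (simp add: Suc.IH)
  also have "\<dots> = msum (geom2 * (geom1 * geom2 ^ l)) x"
    by (rule msum_geom2_mult[symmetric]) (simp add: geom1_def geom2_def fps_power_zeroth)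
  finally show ?case by (simp add: mult_ac)
qed

text \<open>The constant term must be 1 for the local factors of an Euler product; \<open>gt k 0\<close> is a junk value.\<close>

definition gt_fps :: "nat \<Rightarrow> real fps" where
  "gt_fps k = Abs_fps (\<lambda>a. if a = 0 then 1 else real (gt k a))"

text \<open>The local factor of the quotient of \<open>\<Sum> \<tau>(n) n\<^sup>-\<^sup>s\<close> by \<open>\<zeta>(s) \<zeta>(2s)\<^sup>l\<close>, in the variable \<open>p\<^sup>-\<^sup>s\<close>.\<close>

definition corr_fps :: "nat \<Rightarrow> nat \<Rightarrow> real fps" where
  "corr_fps k l = gt_fps k * ((1 - fps_X) * (1 - fps_X ^ 2) ^ l)"

lemma mf_gt_fps:
  assumes "n > 0"
  shows "mf (gt_fps k) n = real (tau_e k n)"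
proof -
  have "(\<Prod>p\<in>prime_factors n. gt_fps k $ multiplicity p n) = (\<Prod>p\<in>prime_factors n. real (gt k (multiplicity p n)))"
    by (intro prod.cong) (simp_all add: gt_fps_def prime_factors_multiplicity)
  thus ?thesis using assms by (simp add: multf_def tau_e_def)
qed

lemma corr_fps_mult: "corr_fps k l * (geom1 * geom2 ^ l) = gt_fps k"
proof -
  have "corr_fps k l * (geom1 * geom2 ^ l)
      = gt_fps k * ((1 - fps_X) * geom1) * ((1 - fps_X ^ 2) * geom2) ^ l"
    by (simp add: corr_fps_def power_mult_distrib mult_ac)
  thus ?thesis by (simp add: geom1 geom2)
qed

text \<open>The series \<open>gt_fps k\<close> starts \<open>1, 1, l + 1\<close>, the last by the
  assumed relation between \<open>k\<close> and \<open>l\<close>, and the multiplier starts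
  \<open>1, -1, -l\<close>. In the product, the coefficient of X is \<open>1 - 1\<close> and that of
  X^2 is \<open>(l + 1) - 1 - l\<close>.\<close>

lemma corr_fps_nth:
  assumes "k \<ge> 1" "k * (k + 1) = 2 * (l + 1)"
  shows "corr_fps k l $ 0 = 1" "corr_fps k l $ 1 = 0" "corr_fps k l $ 2 = 0"
proof -
  have gt1: "gt k 1 = 1" using gt_power_of_2[of k 0] by simp
  have "(k + 1) choose 2 = (k + 1) * k div 2" by (simp add: choose_two)
  also have "\<dots> = l + 1" using assms by (simp add: mult.commute)
  finally have gt2: "gt k 2 = l + 1" using gt_power_of_2[of k 1] by (simp only: power_one_right) simp
  define q :: "real fps" where "q = (1 - fps_X ^ 2) ^ l"
  have q: "q $ 0 = 1" "q $ 1 = 0" "q $ 2 = - real l"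
    unfolding q_def by (induction l) (auto simp: fps_mult_nth numeral_2_eq_2)
  define r where "r = (1 - fps_X) * q"
  have r: "r $ 0 = 1" "r $ 1 = -1" "r $ 2 = - real l"
    using q by (auto simp: r_def fps_mult_nth numeral_2_eq_2)
  have F: "gt_fps k $ 0 = 1" "gt_fps k $ 1 = 1" "gt_fps k $ 2 = real l + 1"
    using gt1 gt2 by (auto simp: gt_fps_def)
  have "corr_fps k l = gt_fps k * r" by (simp add: corr_fps_def r_def q_def)
  thus "corr_fps k l $ 0 = 1" "corr_fps k l $ 1 = 0" "corr_fps k l $ 2 = 0"
    using r F by (simp_all add: fps_mult_nth numeral_2_eq_2)
qed

lemma sum_tau_e_eq:
  assumes "corr_fps k l $ 0 = 1"
  shows "(\<Sum>n\<in>{1..nat \<lfloor>x\<rfloor>}. real (tau_e k n)) = (\<Sum>m\<in>{1..nat \<lfloor>x\<rfloor>}. mf (corr_fps k l) m * real (Dcount l (x / m)))"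
proof -
  have "(\<Sum>n\<in>{1..nat \<lfloor>x\<rfloor>}. real (tau_e k n)) = msum (gt_fps k) x"
    by (simp add: msum_def mf_gt_fps)
  also have "\<dots> = msum (corr_fps k l * (geom1 * geom2 ^ l)) x" by (simp add: corr_fps_mult)
  also have "\<dots> = (\<Sum>m\<in>{1..nat \<lfloor>x\<rfloor>}. mf (corr_fps k l) m * real (Dcount l (x / m)))"
    by (subst msum_mult) (use assms in \<open>auto simp: Dcount_conv geom1_def geom2_def fps_power_zeroth\<close>)
  finally show ?thesis .
qed

section \<open>The correction factor\<close>

text \<open>Comparison with the polynomial majorant of \<open>gt_le\<close>, whose radius is 1 by
  the ratio test.\<close>

lemma fps_conv_radius_gt_fps: "fps_conv_radius (gt_fps k) \<ge> 1"
  unfolding fps_conv_radius_def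
proof (rule conv_radius_geI_ex')
  fix r :: real assume r: "0 < r" "ereal r < 1"
  define h where "h = (\<lambda>n. (2 * real n + 1) ^ (2 * k))"
  have "conv_radius h = 1"
  proof (rule conv_radius_ratio_limit_nonzero[of _ 1])
    have "(\<lambda>n. (2 * real n + 1) / (2 * real (Suc n) + 1)) \<longlonglongrightarrow> 1" by real_asymp
    hence "(\<lambda>n. ((2 * real n + 1) / (2 * real (Suc n) + 1)) ^ (2 * k)) \<longlonglongrightarrow> 1 ^ (2 * k)"
      by (rule tendsto_power)
    thus "(\<lambda>n. norm (h n) / norm (h (Suc n))) \<longlonglongrightarrow> 1"
      by (simp add: h_def power_divide)
  qed (simp_all add: one_ereal_def)
  hence "summable (\<lambda>n. norm (h n * r ^ n))"
    using r by (intro abs_summable_in_conv_radius) simp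
  moreover have "norm (gt_fps k $ n * r ^ n) \<le> norm (h n * r ^ n)" for n
  proof -
    have "real (gt k n) \<le> real ((2 * n + 1) ^ (2 * k))" by (simp only: of_nat_le_iff gt_le)
    hence "\<bar>gt_fps k $ n\<bar> \<le> h n" by (simp add: gt_fps_def h_def add.commute)
    thus ?thesis using r by (simp add: abs_mult mult_right_mono)
  qed
  ultimately have "summable (\<lambda>n. gt_fps k $ n * r ^ n)"
    by (rule summable_comparison_test'[where N = 0])
  thus "summable (\<lambda>n. gt_fps k $ n * of_real r ^ n)" by simp
qed

lemma fps_conv_radius_1_minus_X_power: "fps_conv_radius (1 - fps_X ^ n :: real fps) = \<infinity>"
  using fps_conv_radius_diff[of 1 "fps_X ^ n :: real fps"] by simp

lemma fps_conv_radius_corr_factor: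
  "fps_conv_radius ((1 - fps_X) * (1 - fps_X ^ 2) ^ l :: real fps) = \<infinity>"
proof -
  have "fps_conv_radius (1 - fps_X :: real fps) = \<infinity>"
    using fps_conv_radius_1_minus_X_power[of 1] by simp
  moreover have "fps_conv_radius ((1 - fps_X ^ 2) ^ l :: real fps) = \<infinity>"
    using fps_conv_radius_power[of "1 - fps_X ^ 2 :: real fps" l] by (simp add: fps_conv_radius_1_minus_X_power)
  ultimately show ?thesis
    using fps_conv_radius_mult[of "1 - fps_X :: real fps" "(1 - fps_X ^ 2) ^ l"] by simp
qed

lemma fps_conv_radius_corr_fps: "fps_conv_radius (corr_fps k l) \<ge> 1"
  using fps_conv_radius_mult[of "gt_fps k" "(1 - fps_X) * (1 - fps_X ^ 2) ^ l"] fps_conv_radius_gt_fps[of k]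
  unfolding corr_fps_def fps_conv_radius_corr_factor by (simp add: order.trans)

text \<open>\<open>gt_fps k\<close> has nonnegative coefficients and constant term 1, and the
  polynomial multiplier is positive on (0, 1). Hence no Euler factor of the correction series
  vanishes.\<close>

lemma eval_corr_fps_pos:
  fixes z :: real
  assumes "0 < z" "z < 1"
  shows "eval_fps (corr_fps k l) z > 0"
proof -
  have z: "ereal (norm z) < fps_conv_radius (gt_fps k)"
    using assms by (intro less_le_trans[OF _ fps_conv_radius_gt_fps]) simp
  have pow: "eval_fps (f ^ l) z = eval_fps f z ^ l" if "fps_conv_radius f = \<infinity>" for f :: "real fps" and l
  proof (induction l)
    case (Suc l)
    have "fps_conv_radius (f ^ l) = \<infinity>" using fps_conv_radius_power[of f l] that by simp
    thus ?case using Suc that by (simp add: eval_fps_mult)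
  qed simp
  have e1: "eval_fps (1 - fps_X) z = 1 - z" by (subst eval_fps_diff) simp_all
  have e2: "eval_fps (1 - fps_X ^ 2) z = 1 - z\<^sup>2" by (subst eval_fps_diff) simp_all
  have r: "fps_conv_radius (1 - fps_X :: real fps) = \<infinity>" "fps_conv_radius ((1 - fps_X ^ 2) ^ l :: real fps) = \<infinity>"
    using fps_conv_radius_1_minus_X_power[of 1] fps_conv_radius_power[of "1 - fps_X ^ 2 :: real fps" l]
    by (simp_all add: fps_conv_radius_1_minus_X_power)
  have "eval_fps ((1 - fps_X) * (1 - fps_X ^ 2) ^ l) z = (1 - z) * (1 - z\<^sup>2) ^ l"
    by (subst eval_fps_mult) (simp_all add: r e1 pow fps_conv_radius_1_minus_X_power e2)
  hence "eval_fps (corr_fps k l) z = eval_fps (gt_fps k) z * ((1 - z) * (1 - z\<^sup>2) ^ l)"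
    unfolding corr_fps_def using z by (subst eval_fps_mult) (simp_all add: fps_conv_radius_corr_factor)
  moreover have "eval_fps (gt_fps k) z > 0" unfolding eval_fps_def
    by (rule suminf_pos2[of _ 0]) (use z summable_fps[of z "gt_fps k"] assms in \<open>auto simp: gt_fps_def\<close>)
  moreover have "z\<^sup>2 < 1" using assms by (simp add: power_less_one_iff abs_square_less_1)
  ultimately show ?thesis using assms by simp
qed

context
  fixes g :: "real fps"
  assumes g: "g $ 0 = 1" "g $ 1 = 0" "g $ 2 = 0" and radius: "fps_conv_radius g \<ge> 1"
begin

text \<open>The first three terms contribute exactly 1 and the rest carries a factor
  \<open>z ^ 3\<close>. The remaining series is majorised at \<open>r\<close>, so its constant does
  not depend on \<open>z\<close>, that is, on the prime.\<close>

lemma local_factor_abs: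
  fixes z r :: real
  assumes z: "0 < z" "z \<le> r" and r: "r < 1"
  shows "summable (\<lambda>a. \<bar>g $ a * z ^ a\<bar>)" "(\<Sum>a. \<bar>g $ a * z ^ a\<bar>) \<le> 1 + (\<Sum>a. \<bar>g $ (a + 3)\<bar> * r ^ a) * z ^ 3"
    "(\<Sum>a. \<bar>g $ (a + 3)\<bar> * r ^ a) \<ge> 0"
proof -
  have *: "summable (\<lambda>a. \<bar>g $ a\<bar> * y ^ a)" if "0 \<le> y" "y < 1" for y
  proof -
    have "summable (\<lambda>a. norm (g $ a * y ^ a))"
      by (rule norm_summable_fps) (rule less_le_trans[OF _ radius], use that in simp)
    thus ?thesis using that by (simp add: abs_mult)
  qed
  have **: "summable (\<lambda>a. \<bar>g $ (a + 3)\<bar> * y ^ a)" if "0 < y" "y < 1" for y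
  proof -
    have "summable (\<lambda>a. \<bar>g $ (a + 3)\<bar> * y ^ (a + 3))"
      using summable_ignore_initial_segment[OF *[of y], of 3] that by simp
    from summable_mult[OF this, of "inverse (y ^ 3)"] show ?thesis
      using that by (simp add: power_add field_simps)
  qed
  show 1: "summable (\<lambda>a. \<bar>g $ a * z ^ a\<bar>)" using *[of z] assms by (simp add: abs_mult)
  have "(\<Sum>a. \<bar>g $ a * z ^ a\<bar>) = (\<Sum>a. \<bar>g $ (a + 3) * z ^ (a + 3)\<bar>) + (\<Sum>a<3. \<bar>g $ a * z ^ a\<bar>)"
    by (rule suminf_split_initial_segment[OF 1])
  also have "(\<Sum>a<3. \<bar>g $ a * z ^ a\<bar>) = 1" using g by (simp add: eval_nat_numeral)
  also have "(\<Sum>a. \<bar>g $ (a + 3) * z ^ (a + 3)\<bar>) \<le> (\<Sum>a. \<bar>g $ (a + 3)\<bar> * r ^ a) * z ^ 3"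
  proof -
    note zp = z(1)
    have rp: "r > 0" using z by auto
    have "(\<Sum>a. \<bar>g $ (a + 3) * z ^ (a + 3)\<bar>) = (\<Sum>a. \<bar>g $ (a + 3)\<bar> * z ^ a * z ^ 3)"
      using zp by (simp add: abs_mult power_add mult.assoc)
    also have "\<dots> = (\<Sum>a. \<bar>g $ (a + 3)\<bar> * z ^ a) * z ^ 3"
      by (rule suminf_mult2[symmetric]) (use ** zp z r in auto)
    also have "\<dots> \<le> (\<Sum>a. \<bar>g $ (a + 3)\<bar> * r ^ a) * z ^ 3"
      using zp z r rp by (intro mult_right_mono suminf_le ** mult_left_mono power_mono) auto
    finally show ?thesis .
  qed
  finally show "(\<Sum>a. \<bar>g $ a * z ^ a\<bar>) \<le> 1 + (\<Sum>a. \<bar>g $ (a + 3)\<bar> * r ^ a) * z ^ 3" by simp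
  show "(\<Sum>a. \<bar>g $ (a + 3)\<bar> * r ^ a) \<ge> 0"
    by (rule suminf_nonneg[OF **]) (use z r in auto)
qed

text \<open>At \<open>z = p powr -s\<close> the excess of a local factor over 1 is at most a
  constant times \<open>p powr (-3 * s)\<close>, which is summable for \<open>s > 1/3\<close>. This
  is where the exponent 1/3 comes from.\<close>

lemma
  fixes s :: real
  assumes s: "s > 1/3"
  shows mf_powr_abs_summable: "summable (\<lambda>n. \<bar>mf g n\<bar> * n powr -s)"
    and suminf_mf_powr_nonzero:
      "(\<And>z. 0 < z \<Longrightarrow> z < 1 \<Longrightarrow> eval_fps g z \<noteq> 0) \<Longrightarrow> (\<Sum>n. mf g n * n powr -s) \<noteq> 0"
proof -
  \<comment> \<open>A bound below 1 for \<open>p powr -s\<close>, valid for every prime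
    \<open>p \<ge> 2\<close> and every \<open>s > 1/3\<close>.\<close>
  define r :: real where "r = 2 powr (-1/3)"
  have r: "0 < r" "r < 1" unfolding r_def by (simp_all add: powr_less_one)
  define K where "K = (\<Sum>a. \<bar>g $ (a + 3)\<bar> * r ^ a)"
  define c where "c = (\<lambda>p a. g $ a * (real p powr -s) ^ a)"
  define b where "b = (\<lambda>n. K * (real n powr (-3 * s)))"
  have z: "0 < real p powr -s" "real p powr -s \<le> r" if "prime p" for p
  proof -
    have p: "real p \<ge> 2" using prime_ge_2_nat[OF that] by simp
    have "real p powr -s \<le> 2 powr -s" using p s by (intro powr_mono2') auto
    also have "\<dots> \<le> r" unfolding r_def using s by (intro powr_mono) auto
    finally show "0 < real p powr -s" "real p powr -s \<le> r" using p by auto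
  qed
  have pow3: "(real p powr -s) ^ 3 = real p powr (-3 * s)" if "prime p" for p
    using prime_gt_0_nat[OF that] by (simp add: powr_powr mult.commute flip: powr_realpow)
  have c0: "c q 0 = 1" for q using g by (simp add: c_def)
  have sc: "summable (\<lambda>a. \<bar>c p a\<bar>)" if "prime p" for p
    unfolding c_def using z[OF that] r by (intro local_factor_abs(1)[of _ r]) auto
  have bd: "(\<Sum>a. \<bar>c p a\<bar>) \<le> 1 + b p" if "prime p" for p
    using local_factor_abs(2)[of "real p powr -s" r] z[OF that] r pow3[OF that]
    by (simp add: c_def b_def K_def)
  have K0: "K \<ge> 0"
    unfolding K_def by (rule local_factor_abs(3)[of r]) (use r in auto)
  have b: "summable b" unfolding b_def using s by (intro summable_mult) (simp add: summable_real_powr_iff)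
  have b0: "b n \<ge> 0" for n by (simp add: b_def K0)
  have eq: "multf c n = mf g n * real n powr -s" for n
    unfolding c_def by (rule multf_powr) (rule g)
  have "summable (\<lambda>n. \<bar>multf c n\<bar>)"
    by (rule multf_abs_summable[OF c0 sc bd b b0])
  thus "summable (\<lambda>n. \<bar>mf g n\<bar> * n powr -s)" by (simp add: eq abs_mult)
  assume nz: "\<And>z. 0 < z \<Longrightarrow> z < 1 \<Longrightarrow> eval_fps g z \<noteq> 0"
  have "(\<Sum>n. multf c n) \<noteq> 0"
  proof (rule suminf_multf_nonzero[OF c0 sc bd b b0])
    fix p :: nat assume "prime p"
    thus "(\<Sum>a. c p a) \<noteq> 0" using nz[of "real p powr -s"] z[of p] r by (simp add: c_def eval_fps_def)
  qed
  thus "(\<Sum>n. mf g n * n powr -s) \<noteq> 0" by (simp add: eq)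
qed

end

section \<open>Polynomials in the logarithm: growth and shifted argument\<close>

lemma abs_poly_le_exp:
  fixes Q :: "real poly"
  assumes "d > 0"
  shows "\<exists>K\<ge>0. \<forall>t. \<bar>poly Q t\<bar> \<le> K * exp (d * \<bar>t\<bar>)"
  using assms
proof (induction Q arbitrary: d)
  case (pCons a Q)
  \<comment> \<open>Half of the exponent bounds \<open>poly Q t\<close>; the other half absorbs the
    new factor \<open>t\<close>.\<close>
  from pCons.IH[of "d / 2"] pCons.prems obtain K
    where K: "K \<ge> 0" "\<And>t. \<bar>poly Q t\<bar> \<le> K * exp (d / 2 * \<bar>t\<bar>)" by auto
  have "\<bar>poly (pCons a Q) t\<bar> \<le> (\<bar>a\<bar> + 2 / d * K) * exp (d * \<bar>t\<bar>)" for t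
  proof -
    have "d / 2 * \<bar>t\<bar> \<le> exp (d / 2 * \<bar>t\<bar>)" using exp_ge_add_one_self[of "d / 2 * \<bar>t\<bar>"] by linarith
    hence t: "\<bar>t\<bar> \<le> 2 / d * exp (d / 2 * \<bar>t\<bar>)" using pCons.prems by (simp add: field_simps)
    have "\<bar>t * poly Q t\<bar> \<le> (2 / d * exp (d / 2 * \<bar>t\<bar>)) * (K * exp (d / 2 * \<bar>t\<bar>))"
      unfolding abs_mult by (rule mult_mono[OF t K(2)]) (use pCons.prems in auto)
    also have "\<dots> = 2 / d * K * exp (d * \<bar>t\<bar>)" by (simp add: field_simps flip: exp_add)
    finally have "\<bar>t * poly Q t\<bar> \<le> 2 / d * K * exp (d * \<bar>t\<bar>)" .
    moreover have "\<bar>a\<bar> * 1 \<le> \<bar>a\<bar> * exp (d * \<bar>t\<bar>)" using pCons.prems by (intro mult_left_mono) auto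
    ultimately show ?thesis by (simp add: ring_distribs)
  qed
  moreover have "\<bar>a\<bar> + 2 / d * K \<ge> 0" using K(1) pCons.prems by simp
  ultimately show ?case by blast
qed auto

text \<open>Separating \<open>x\<close> from \<open>t\<close> lets a sum over
  \<open>t = ln n\<close> be taken coefficient by coefficient. The top coefficient is constant in
  \<open>t\<close>, which will fix the degree of the summed polynomial.\<close>

lemma poly_diff_expansion:
  fixes Q :: "real poly"
  defines "R \<equiv> \<lambda>i. \<Sum>j\<le>degree Q. smult (coeff Q j * (j choose i)) ([:0, -1:] ^ (j - i))"
  shows "poly Q (x - t) = (\<Sum>i\<le>degree Q. poly (R i) t * x ^ i)" "R (degree Q) = [:lead_coeff Q:]"
proof -
  have "poly Q (x - t) = (\<Sum>j\<le>degree Q. coeff Q j * (x + -t) ^ j)"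
    by (simp add: poly_altdef)
  also have "\<dots> = (\<Sum>j\<le>degree Q. \<Sum>i\<le>degree Q. coeff Q j * (j choose i) * (-t) ^ (j - i) * x ^ i)"
  proof (rule sum.cong)
    fix j assume "j \<in> {..degree Q}"
    \<comment> \<open>Binomials with \<open>i > j\<close> vanish, so the range of \<open>i\<close>
      can be made independent of \<open>j\<close> before the sums are swapped.\<close>
    hence "(\<Sum>i\<le>degree Q. (j choose i) * x ^ i * (-t) ^ (j - i)) = (\<Sum>i\<le>j. (j choose i) * x ^ i * (-t) ^ (j - i))"
      by (intro sum.mono_neutral_right) auto
    hence "coeff Q j * (x + -t) ^ j = coeff Q j * (\<Sum>i\<le>degree Q. (j choose i) * x ^ i * (-t) ^ (j - i))"
      by (simp only: binomial_ring)
    thus "coeff Q j * (x + -t) ^ j = (\<Sum>i\<le>degree Q. coeff Q j * (j choose i) * (-t) ^ (j - i) * x ^ i)"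
      by (simp add: sum_distrib_left mult_ac)
  qed simp
  also have "\<dots> = (\<Sum>i\<le>degree Q. \<Sum>j\<le>degree Q. coeff Q j * (j choose i) * (-t) ^ (j - i) * x ^ i)"
    by (rule sum.swap)
  also have "\<dots> = (\<Sum>i\<le>degree Q. poly (R i) t * x ^ i)"
    by (simp add: R_def poly_sum sum_distrib_right)
  finally show "poly Q (x - t) = (\<Sum>i\<le>degree Q. poly (R i) t * x ^ i)" .
  have "R (degree Q) = (\<Sum>j\<in>{degree Q}. smult (coeff Q j * (j choose degree Q)) ([:0, -1:] ^ (j - degree Q)))"
    unfolding R_def by (rule sum.mono_neutral_right) auto
  thus "R (degree Q) = [:lead_coeff Q:]" by simp
qed

section \<open>Transfer of the asymptotic expansion\<close>

context
  fixes g :: "nat \<Rightarrow> real"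
  assumes g0: "g 0 = 0" and g_sum: "\<And>s. s > 1/3 \<Longrightarrow> summable (\<lambda>n. \<bar>g n\<bar> * n powr -s)"
begin

text \<open>Summing the expansion termwise gives coefficients \<open>S i\<close>. The top one is
  \<open>lead_coeff Q\<close> times the series assumed nonzero in \<open>nz\<close>, so the degree
  is preserved.\<close>

lemma log_weighted_polynomial:
  fixes Q :: "real poly"
  assumes nz: "(\<Sum>n. g n * n powr -(1/2)) \<noteq> 0" and Q: "Q \<noteq> 0"
  obtains P where "degree P = degree Q"
    "\<And>x. (\<lambda>n. g n * n powr -(1/2) * poly Q (x - ln n)) sums poly P x"
proof -
  define R where "R = (\<lambda>i. \<Sum>j\<le>degree Q. smult (coeff Q j * (j choose i)) ([:0, -1:] ^ (j - i)))"
  have R: "poly Q (x - t) = (\<Sum>i\<le>degree Q. poly (R i) t * x ^ i)" "R (degree Q) = [:lead_coeff Q:]" for x t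
    unfolding R_def by (rule poly_diff_expansion)+
  define S where "S = (\<lambda>i. \<Sum>n. g n * n powr -(1/2) * poly (R i) (ln n))"
  define P where "P = (\<Sum>i\<le>degree Q. monom (S i) i)"
  have S: "(\<lambda>n. g n * n powr -(1/2) * poly (R i) (ln n)) sums S i" for i
  proof -
    \<comment> \<open>A loss of 1/12 in the exponent is affordable: \<open>1/2 - 1/12 = 5/12\<close>
      still exceeds 1/3.\<close>
    obtain K where K: "K \<ge> 0" "\<And>t. \<bar>poly (R i) t\<bar> \<le> K * exp (1/12 * \<bar>t\<bar>)"
      using abs_poly_le_exp[of "1/12" "R i"] by auto
    have "norm (g n * n powr -(1/2) * poly (R i) (ln n)) \<le> K * (\<bar>g n\<bar> * n powr -(5/12))" for n :: nat
    proof (cases "n = 0")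
      case False
      hence "\<bar>poly (R i) (ln n)\<bar> \<le> K * n powr (1/12)"
        using K(2)[of "ln n"] by (simp add: powr_def)
      hence "\<bar>g n\<bar> * n powr -(1/2) * \<bar>poly (R i) (ln n)\<bar> \<le> \<bar>g n\<bar> * n powr -(1/2) * (K * n powr (1/12))"
        by (intro mult_left_mono) auto
      also have "\<dots> = K * (\<bar>g n\<bar> * (n powr -(1/2) * n powr (1/12)))" by (simp add: mult_ac)
      also have "n powr -(1/2) * n powr (1/12) = n powr -(5/12)" by (simp flip: powr_add)
      finally show ?thesis by (simp add: abs_mult)
    qed (simp add: g0)
    hence "summable (\<lambda>n. g n * n powr -(1/2) * poly (R i) (ln n))"
      by (intro summable_comparison_test'[OF summable_mult[OF g_sum[of "5/12"], of K], of 0]) auto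
    thus ?thesis unfolding S_def by (rule summable_sums)
  qed
  have "summable (\<lambda>n. g n * n powr -(1/2))"
    by (rule summable_rabs_cancel) (use g_sum[of "1/2"] in \<open>simp add: abs_mult\<close>)
  hence "S (degree Q) = (\<Sum>n. g n * n powr -(1/2)) * lead_coeff Q"
    unfolding S_def R(2) by (simp add: suminf_mult2)
  hence Sn: "S (degree Q) \<noteq> 0" using nz Q by simp
  have coeffP: "coeff P i = (if i \<le> degree Q then S i else 0)" for i
    by (simp add: P_def coeff_sum)
  have "degree P = degree Q"
  proof (rule antisym)
    show "degree P \<le> degree Q" by (rule degree_le) (simp add: coeffP)
    show "degree Q \<le> degree P" by (rule le_degree) (simp add: coeffP Sn)
  qed
  moreover have "(\<lambda>n. g n * n powr -(1/2) * poly Q (x - ln n)) sums poly P x" for x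
  proof -
    have "(\<lambda>n. \<Sum>i\<le>degree Q. g n * n powr -(1/2) * poly (R i) (ln n) * x ^ i) sums (\<Sum>i\<le>degree Q. S i * x ^ i)"
      by (intro sums_sum sums_mult2 S)
    thus ?thesis
      by (simp add: R(1) P_def poly_sum poly_monom sum_distrib_left mult.assoc)
  qed
  ultimately show ?thesis by (rule that)
qed

text \<open>The difference to be estimated is the sum of \<open>g m * E (x / m)\<close> over all
  \<open>m\<close>, with \<open>E\<close> the error term of \<open>D\<close>. Bounding
  \<open>E\<close> by powers with exponents above 1/3 leaves absolutely convergent series in
  \<open>m\<close>.\<close>

lemma sum_convolution_bigo:
  fixes D :: "real \<Rightarrow> real" and P Q :: "real poly" and C w :: real
  assumes D0: "\<And>y. y < 1 \<Longrightarrow> D y = 0" and D_mono: "mono D"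
    and D: "\<And>e. e > 0 \<Longrightarrow> (\<lambda>x. D x - C * x - sqrt x * poly Q (ln x)) \<in> O(\<lambda>x. x powr (w + e))"
    and P: "\<And>x. (\<lambda>n. g n * n powr -(1/2) * poly Q (x - ln n)) sums poly P x"
    and e: "e > 0"
  shows "(\<lambda>x. (\<Sum>m\<in>{1..nat \<lfloor>x\<rfloor>}. g m * D (x / m)) - C * (\<Sum>n. g n * n powr -1) * x - sqrt x * poly P (ln x))
           \<in> O(\<lambda>x. x powr (max w (1/3) + e))"
proof -
  \<comment> \<open>The exponent \<open>v\<close> serves arguments at least 1 and \<open>u\<close>
    those below 1. The cap 1/12 keeps \<open>u\<close> at most \<open>5/12\<close>, the exponent
    left to the square root after the logarithms are absorbed.\<close>
  define \<delta> where "\<delta> = min e (1/12)"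
  have \<delta>: "0 < \<delta>" "\<delta> \<le> e" "\<delta> \<le> 1/12" using e by (auto simp: \<delta>_def)
  define v where "v = max w (1/3) + \<delta>"
  define u where "u = 1/3 + \<delta>"
  have uv: "u \<le> v" "v > 1/3" "u > 1/3" "u \<le> 5/12" using \<delta> by (auto simp: u_def v_def)
  \<comment> \<open>Bounding \<open>E\<close> on \<open>(0, 1)\<close> as well, where \<open>D\<close> vanishes, allows all sums over \<open>m\<close> to run to infinity.\<close>
  define E where "E = (\<lambda>x. D x - C * x - sqrt x * poly Q (ln x))"
  have D_nonneg: "D y \<ge> 0" for y
    using D0[of "min y 0"] monoD[OF D_mono, of "min y 0" y] by simp
  obtain Kq where Kq: "Kq \<ge> 0" "\<And>t. \<bar>poly Q t\<bar> \<le> Kq * exp (1/12 * \<bar>t\<bar>)"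
    using abs_poly_le_exp[of "1/12" Q] by auto
  \<comment> \<open>Here \<open>D\<close> vanishes, so \<open>E\<close> consists of the two main
    terms. For \<open>y < 1\<close> a smaller exponent gives a larger power, so both are bounded by
    a multiple of \<open>y powr u\<close>.\<close>
  have E_small: "\<bar>E y\<bar> \<le> (\<bar>C\<bar> + Kq) * y powr u" if y: "0 < y" "y < 1" for y
  proof -
    have "\<bar>C * y\<bar> \<le> \<bar>C\<bar> * y powr u"
      using powr_mono'[of u 1 y] uv y by (simp add: abs_mult mult_left_mono)
    moreover have "\<bar>sqrt y * poly Q (ln y)\<bar> \<le> Kq * y powr u"
    proof -
      have "exp (1/12 * \<bar>ln y\<bar>) = y powr -(1/12)" using y by (simp add: powr_def)
      hence "\<bar>sqrt y * poly Q (ln y)\<bar> \<le> y powr (1/2) * (Kq * y powr -(1/12))"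
        using Kq(2)[of "ln y"] y by (simp add: abs_mult powr_half_sqrt mult_left_mono)
      also have "\<dots> = Kq * (y powr (1/2) * y powr -(1/12))" by simp
      also have "y powr (1/2) * y powr -(1/12) = y powr (5/12)" by (simp flip: powr_add)
      also have "Kq * y powr (5/12) \<le> Kq * y powr u"
        using powr_mono'[of u "5/12" y] uv y Kq(1) by (intro mult_left_mono) auto
      finally show ?thesis .
    qed
    moreover have "E y = - (C * y) - sqrt y * poly Q (ln y)" using D0 y by (simp add: E_def)
    ultimately show ?thesis by (simp add: ring_distribs)
  qed
  have "E \<in> O(\<lambda>x. x powr v)"
  proof -
    have "E \<in> O(\<lambda>x. x powr (w + \<delta>))" unfolding E_def by (rule D) (rule \<delta>)
    moreover have "(\<lambda>x. x powr (w + \<delta>)) \<in> O(\<lambda>x::real. x powr v)"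
    proof (rule bigoI[of _ 1])
      show "\<forall>\<^sub>F x in at_top. norm (x powr (w + \<delta>)) \<le> 1 * norm (x powr v)"
        using eventually_ge_at_top[of 1] by eventually_elim (auto simp: v_def intro!: powr_mono)
    qed
    ultimately show ?thesis by (rule landau_o.big_trans)
  qed
  then obtain c where c: "c > 0" "\<forall>\<^sub>F x in at_top. norm (E x) \<le> c * norm (x powr v)"
    by (auto elim: landau_o.bigE)
  then obtain y0 where y0: "\<And>y. y \<ge> y0 \<Longrightarrow> \<bar>E y\<bar> \<le> c * y powr v"
    by (auto simp: eventually_at_top_linorder)
  \<comment> \<open>The asymptotic bound says nothing on the interval from 1 to \<open>z\<close>.
    There the monotonicity of \<open>D\<close> and the values at \<open>z\<close> give the constant
    bound \<open>K0\<close>.\<close>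
  define z where "z = max y0 1"
  define K0 where "K0 = D z + \<bar>C\<bar> * z + sqrt z * (Kq * exp (1/12 * ln z))"
  have K0: "K0 \<ge> 0" unfolding K0_def using D_nonneg[of z] Kq(1) by (auto simp: z_def intro!: add_nonneg_nonneg)
  have E_large: "\<bar>E y\<bar> \<le> (c + K0) * y powr v" if y: "y \<ge> 1" for y
  proof (cases "y \<ge> z")
    case True
    hence "\<bar>E y\<bar> \<le> c * y powr v" by (intro y0) (simp add: z_def)
    thus ?thesis using K0 by (simp add: ring_distribs add_increasing2)
  next
    case False
    have "\<bar>D y\<bar> \<le> D z" using False D_nonneg[of y] monoD[OF D_mono, of y z] by simp
    moreover have "\<bar>C * y\<bar> \<le> \<bar>C\<bar> * z" using False y by (simp add: abs_mult mult_left_mono)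
    moreover have "\<bar>sqrt y * poly Q (ln y)\<bar> \<le> sqrt z * (Kq * exp (1/12 * ln z))"
    proof -
      have "\<bar>poly Q (ln y)\<bar> \<le> Kq * exp (1/12 * \<bar>ln y\<bar>)" by (rule Kq)
      also have "\<dots> \<le> Kq * exp (1/12 * ln z)"
        using False y Kq(1) by (intro mult_left_mono) auto
      finally show ?thesis unfolding abs_mult using False y by (intro mult_mono) auto
    qed
    ultimately have "\<bar>E y\<bar> \<le> K0" unfolding E_def K0_def by linarith
    also have "K0 * 1 \<le> K0 * y powr v" using K0 y uv by (intro mult_left_mono ge_one_powr_ge_zero) auto
    hence "K0 \<le> (c + K0) * y powr v" using c(1) by (simp add: ring_distribs add_increasing)
    finally show ?thesis .
  qed
  define K where "K = \<bar>C\<bar> + Kq + c + K0"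
  have K: "K \<ge> 0" using Kq(1) c(1) K0 by (simp add: K_def)
  have E_bound: "\<bar>E y\<bar> \<le> K * (y powr v + y powr u)" if "y > 0" for y
  proof (cases "y < 1")
    case True
    have "(\<bar>C\<bar> + Kq) * y powr u \<le> K * (y powr v + y powr u)"
      using c(1) K0 Kq(1) by (intro mult_mono) (auto simp: K_def)
    thus ?thesis using E_small[OF that True] by linarith
  next
    case False
    have "(c + K0) * y powr v \<le> K * (y powr v + y powr u)"
      using c(1) K0 Kq(1) by (intro mult_mono) (auto simp: K_def)
    thus ?thesis using E_large[of y] False by linarith
  qed
  define Sv where "Sv = (\<Sum>n. \<bar>g n\<bar> * n powr -v)"
  define Su where "Su = (\<Sum>n. \<bar>g n\<bar> * n powr -u)"
  define A where "A = (\<Sum>n. g n * n powr -1)"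
  have Sv: "(\<lambda>n. \<bar>g n\<bar> * n powr -v) sums Sv" unfolding Sv_def by (intro summable_sums g_sum uv)
  have Su: "(\<lambda>n. \<bar>g n\<bar> * n powr -u) sums Su" unfolding Su_def by (intro summable_sums g_sum uv)
  have Sv0: "Sv \<ge> 0" and Su0: "Su \<ge> 0"
    using sums_le[OF _ sums_zero Sv] sums_le[OF _ sums_zero Su] by auto
  have A: "(\<lambda>n. g n * n powr -1) sums A" unfolding A_def
    by (rule summable_sums, rule summable_rabs_cancel) (use g_sum[of 1] in \<open>simp add: abs_mult\<close>)
  define T where "T = (\<lambda>x. \<Sum>m\<in>{1..nat \<lfloor>x\<rfloor>}. g m * D (x / m))"
  have main: "\<bar>T x - C * A * x - sqrt x * poly P (ln x)\<bar> \<le> K * (Sv + Su) * x powr (max w (1/3) + e)" if x: "x \<ge> 1" for x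
  proof -
    \<comment> \<open>The finite sum is rewritten as a series: terms with \<open>m > x\<close>
      vanish because \<open>D\<close> is 0 below 1, and the term \<open>m = 0\<close> because of
      \<open>g0\<close>. The main terms can then be subtracted as complete series.\<close>
    have sT: "(\<lambda>m. g m * D (x / m)) sums T x"
      unfolding T_def
    proof (rule sums_finite)
      fix m assume m: "m \<notin> {1..nat \<lfloor>x\<rfloor>}"
      show "g m * D (x / m) = 0"
      proof (cases "m = 0")
        case False
        hence "nat \<lfloor>x\<rfloor> < m" using m by auto
        hence "x < real m" by linarith
        hence "x / m < 1" using x by simp
        thus ?thesis by (simp add: D0)
      qed (simp add: g0)
    qed simp
    have s1: "(\<lambda>m. g m * (C * (x / m))) sums (C * A * x)"
    proof -
      have "(\<lambda>m. (C * x) * (g m * m powr -1)) sums (C * x * A)" by (rule sums_mult[OF A])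
      moreover have "(C * x) * (g m * m powr -1) = g m * (C * (x / m))" for m :: nat
        by (cases "m = 0") (simp_all add: g0 powr_minus_divide)
      ultimately show ?thesis by (simp add: mult_ac)
    qed
    have s2: "(\<lambda>m. g m * (sqrt (x / m) * poly Q (ln (x / m)))) sums (sqrt x * poly P (ln x))"
    proof -
      have "(\<lambda>m. sqrt x * (g m * m powr -(1/2) * poly Q (ln x - ln m))) sums (sqrt x * poly P (ln x))"
        by (rule sums_mult[OF P])
      moreover have "sqrt x * (g m * m powr -(1/2) * poly Q (ln x - ln m))
          = g m * (sqrt (x / m) * poly Q (ln (x / m)))" for m :: nat
        using x by (cases "m = 0")
          (simp_all add: g0 powr_minus_divide powr_half_sqrt real_sqrt_divide ln_div)
      ultimately show ?thesis by simp
    qed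
    have sE: "(\<lambda>m. g m * E (x / m)) sums (T x - C * A * x - sqrt x * poly P (ln x))"
      using sums_diff[OF sums_diff[OF sT s1] s2] by (simp add: E_def algebra_simps)
    have b: "(\<lambda>m. K * (x powr v * (\<bar>g m\<bar> * m powr -v) + x powr u * (\<bar>g m\<bar> * m powr -u)))
        sums (K * (x powr v * Sv + x powr u * Su))"
      by (intro sums_mult sums_add Sv Su)
    have le: "\<bar>g m * E (x / m)\<bar> \<le> K * (x powr v * (\<bar>g m\<bar> * m powr -v) + x powr u * (\<bar>g m\<bar> * m powr -u))" for m
    proof (cases "m = 0")
      case False
      have "\<bar>g m\<bar> * \<bar>E (x / m)\<bar> \<le> \<bar>g m\<bar> * (K * ((x / m) powr v + (x / m) powr u))"
        using E_bound[of "x / m"] False x by (intro mult_left_mono) auto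
      also have "\<dots> = K * (x powr v * (\<bar>g m\<bar> * m powr -v) + x powr u * (\<bar>g m\<bar> * m powr -u))"
        using x by (simp add: powr_divide powr_minus_divide algebra_simps)
      finally show ?thesis by (simp add: abs_mult)
    qed (simp add: g0)
    have "\<bar>T x - C * A * x - sqrt x * poly P (ln x)\<bar> \<le> K * (x powr v * Sv + x powr u * Su)"
    proof (rule abs_leI)
      show "T x - C * A * x - sqrt x * poly P (ln x) \<le> K * (x powr v * Sv + x powr u * Su)"
        by (rule sums_le[OF _ sE b]) (use le abs_le_D1 in blast)
      show "- (T x - C * A * x - sqrt x * poly P (ln x)) \<le> K * (x powr v * Sv + x powr u * Su)"
        by (rule sums_le[OF _ sums_minus[OF sE] b]) (use le abs_le_D2 in blast)
    qed
    \<comment> \<open>Both \<open>u\<close> and \<open>v\<close> are at most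
      \<open>max w (1/3) + e\<close>, and \<open>x \<ge> 1\<close>.\<close>
    also have "\<dots> \<le> K * (x powr (max w (1/3) + e) * Sv + x powr (max w (1/3) + e) * Su)"
      using x \<delta> Sv0 Su0 K by (intro mult_left_mono add_mono mult_right_mono powr_mono) (auto simp: u_def v_def)
    also have "\<dots> = K * (Sv + Su) * x powr (max w (1/3) + e)" by (simp add: algebra_simps)
    finally show ?thesis .
  qed
  show ?thesis
  proof (rule bigoI[of _ "K * (Sv + Su)"])
    show "\<forall>\<^sub>F x in at_top. norm ((\<Sum>m\<in>{1..nat \<lfloor>x\<rfloor>}. g m * D (x / m)) - C * (\<Sum>n. g n * n powr -1) * x - sqrt x * poly P (ln x))
        \<le> K * (Sv + Su) * norm (x powr (max w (1/3) + e))"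
      using eventually_ge_at_top[of 1]
      by eventually_elim (use main in \<open>simp add: T_def A_def\<close>)
  qed
qed

end

section \<open>Assembly of the asymptotic formula\<close>

lemma mono_Dcount: "mono (Dcount l)"
proof (rule monoI)
  fix x y :: real assume "x \<le> y"
  hence "Dlists l x \<subseteq> Dlists l y" by (auto simp: Dlists_def)
  thus "Dcount l x \<le> Dcount l y" unfolding Dcount_eq_card by (intro card_mono finite_Dlists)
qed

theorem theorem3:
  fixes k l :: nat and w :: real
  assumes "k \<ge> 2"
    and "l = (k^2 + k - 2) div 2"
    and "\<exists>(C1::real) (Q::real poly). degree Q = l - 1 \<and>
          (\<forall>\<epsilon>>0. (\<lambda>x. real (Dcount l x) - C1 * x - sqrt x * poly Q (ln x))
                   \<in> O[at_top](\<lambda>x. x powr (w + \<epsilon>)))"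
  shows "\<exists>(A::real) (P::real poly). degree P = (k^2 + k - 4) div 2 \<and>
          (\<forall>\<epsilon>>0. (\<lambda>x. (\<Sum>n\<in>{1..nat \<lfloor>x\<rfloor>}. real (tau_e k n)) - A * x - sqrt x * poly P (ln x))
                   \<in> O[at_top](\<lambda>x. x powr (max w (1/3) + \<epsilon>)))"
proof -
  obtain C :: real and Q :: "real poly" where degQ: "degree Q = l - 1"
    and D: "\<And>e. e > 0 \<Longrightarrow> (\<lambda>x. real (Dcount l x) - C * x - sqrt x * poly Q (ln x)) \<in> O(\<lambda>x. x powr (w + e))"
    using assms(3) by blast
  have k2: "k * k \<ge> 2 * k" using assms(1) by simp
  \<comment> \<open>Writing \<open>k\<^sup>2 + k = 2 * j\<close> with \<open>j \<ge> 3\<close>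
    resolves the integer divisions and truncated subtractions: \<open>l = j - 1\<close>, and the
    required degree is \<open>j - 2\<close>.\<close>
  have "even (k * k + k)" by simp
  then obtain j where j: "k * k + k = 2 * j" by (elim evenE)
  have "2 * j \<ge> 6" using j k2 assms(1) by linarith
  moreover have sq: "k\<^sup>2 + k = 2 * j" using j by (simp add: power2_eq_square)
  moreover have l: "l = j - 1" unfolding assms(2) sq by simp
  ultimately have kl: "k * (k + 1) = 2 * (l + 1)" and l2: "l \<ge> 2" and deg: "(k\<^sup>2 + k - 4) div 2 = l - 1"
    using j by simp_all
  define G where "G = corr_fps k l"
  have G: "fps_nth G 0 = 1" "fps_nth G 1 = 0" "fps_nth G 2 = 0"
    using corr_fps_nth[of k l] kl assms(1) by (simp_all add: G_def)
  have rG: "fps_conv_radius G \<ge> 1" unfolding G_def by (rule fps_conv_radius_corr_fps)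
  have sum: "summable (\<lambda>n. \<bar>mf G n\<bar> * n powr -s)" if "s > 1/3" for s
    by (rule mf_powr_abs_summable[OF G rG that])
  have "(\<Sum>n. mf G n * n powr -(1/2)) \<noteq> 0"
    by (rule suminf_mf_powr_nonzero[OF G rG]) (use eval_corr_fps_pos in \<open>auto simp: G_def less_imp_neq[symmetric]\<close>)
  \<comment> \<open>\<open>l \<ge> 2\<close> makes the degree of \<open>Q\<close> positive, which
    excludes the zero polynomial.\<close>
  moreover have "Q \<noteq> 0" using degQ l2 by auto
  ultimately obtain P where P: "degree P = degree Q"
      "\<And>x. (\<lambda>n. mf G n * n powr -(1/2) * poly Q (x - ln n)) sums poly P x"
    using log_weighted_polynomial[of "mf G" Q] sum by auto
  show ?thesis
  proof (intro exI conjI allI impI)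
    show "degree P = (k\<^sup>2 + k - 4) div 2" using P(1) degQ deg by simp
    fix e :: real assume e: "e > 0"
    have "(\<Sum>n\<in>{1..nat \<lfloor>x\<rfloor>}. real (tau_e k n)) = (\<Sum>m\<in>{1..nat \<lfloor>x\<rfloor>}. mf G m * real (Dcount l (x / m)))" for x
      unfolding G_def by (rule sum_tau_e_eq) (use G in \<open>simp add: G_def\<close>)
    moreover have "(\<lambda>x. (\<Sum>m\<in>{1..nat \<lfloor>x\<rfloor>}. mf G m * real (Dcount l (x / m)))
        - C * (\<Sum>n. mf G n * n powr -1) * x - sqrt x * poly P (ln x)) \<in> O(\<lambda>x. x powr (max w (1/3) + e))"
    proof (rule sum_convolution_bigo[OF _ sum _ _ D P(2) e])
      show "mono (\<lambda>y. real (Dcount l y))" using monoD[OF mono_Dcount] by (auto intro!: monoI)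
    qed (simp_all add: Dcount_conv msum_eq_0)
    ultimately show "(\<lambda>x. (\<Sum>n\<in>{1..nat \<lfloor>x\<rfloor>}. real (tau_e k n))
        - C * (\<Sum>n. mf G n * n powr -1) * x - sqrt x * poly P (ln x)) \<in> O(\<lambda>x. x powr (max w (1/3) + e))"
      by simp
  qed
qed

end
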